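(* \textsc{Colorful Graph Motif} on trees admits a problem kernel with at most $2\ell+1$ vertices that can be computed in $\mathcal{O}(n)$ time, where $n=|V|$ and $\ell=|V|-|M|$.
   Context: \textsc{Colorful Graph Motif}: the input is a set $M$ of colors from a color set $C$, an undirected graph $G=(V,E)$ (here a tree), and a coloring $\chi:V\to C$; the question is whether there is $S\subseteq V$ with $G[S]$ connected and a one-to-one mapping $f:S\to M$ with $f(v)=\chi(v)$ for all $v\in S$. A problem kernel is a polynomial-time algorithm that maps an instance with parameter $\ell$ to an equivalent instance (yes iff yes) whose size is bounded by a function of $\ell$. *)

theory Defs
  imports "Graph_Theory.Graph_Theory" "HOL-Library.Landau_Symbols" "HOL-Library.FuncSet"
begin

section \<open>Colorful Graph Motif on trees\<close>

text \<open>
  A finite simple undirected graph is a symmetric loop-free digraph (locale \<^verbatim>\<open>pair_graph\<close>), in which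
  every undirected edge is present as two opposite arcs. The library's \<^verbatim>\<open>forest\<close> and \<^verbatim>\<open>tree\<close> cannot
  be used on this representation, because they count the closed walk along an arc and back as a
  cycle. A cycle of an undirected simple graph has length at least 3.
\<close>

definition undirected_tree :: "'v pair_pre_digraph \<Rightarrow> bool" where
  "undirected_tree G \<longleftrightarrow>
     pair_graph G \<and>
     Digraph_Component.connected (with_proj G) \<and>
     \<not> (\<exists>p. pre_digraph.cycle (with_proj G) p \<and> 3 \<le> length p)"

record ('v, 'c) cgm =
  cgm_graph :: "'v pair_pre_digraph"
  cgm_colors :: "'c set"
  cgm_coloring :: "'v \<Rightarrow> 'c"
  cgm_motif :: "'c set"

text \<open>The last conjunct says that the parameter \<open>|V| - |M|\<close> is a natural number.\<close>

definition cgm_tree_instance :: "('v, 'c) cgm \<Rightarrow> bool" where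
  "cgm_tree_instance I \<longleftrightarrow>
     undirected_tree (cgm_graph I) \<and>
     finite (cgm_colors I) \<and>
     cgm_coloring I \<in> pverts (cgm_graph I) \<rightarrow> cgm_colors I \<and>
     cgm_motif I \<subseteq> cgm_colors I \<and>
     card (cgm_motif I) \<le> card (pverts (cgm_graph I))"

definition cgm_yes :: "('v, 'c) cgm \<Rightarrow> bool" where
  "cgm_yes I \<longleftrightarrow>
     (\<exists>S \<subseteq> pverts (cgm_graph I).
        Digraph_Component.connected (with_proj (cgm_graph I) \<restriction> S) \<and>
        (\<exists>f. bij_betw f S (cgm_motif I) \<and> (\<forall>v\<in>S. f v = cgm_coloring I v)))"

definition cgm_num_verts :: "('v, 'c) cgm \<Rightarrow> nat" where
  "cgm_num_verts I = card (pverts (cgm_graph I))"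

definition cgm_param :: "('v, 'c) cgm \<Rightarrow> nat" where
  "cgm_param I = cgm_num_verts I - card (cgm_motif I)"

definition cgm_size :: "('v, 'c) cgm \<Rightarrow> nat" where
  "cgm_size I = cgm_num_verts I + card (parcs (cgm_graph I)) + card (cgm_colors I) + card (cgm_motif I)"

text \<open>
  Input format: vertices and colors are numbered from 0, and a word list consists of the four
  numbers \<open>|V|\<close>, \<open>|C|\<close>, \<open>|M|\<close>, \<open>|E|\<close>, the motif colors in any order, the color of each vertex, and
  the first and then the second end points of the edges. Each undirected edge is listed once, in
  any order and orientation.
\<close>

definition cgm_code :: "nat list \<Rightarrow> (nat, nat) cgm \<Rightarrow> bool" where
  "cgm_code w I \<longleftrightarrow>
     cgm_tree_instance I \<and>
     (\<exists>n c ms es.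
        pverts (cgm_graph I) = {0..<n} \<and>
        cgm_colors I = {0..<c} \<and>
        distinct ms \<and> set ms = cgm_motif I \<and>
        distinct es \<and> set es \<inter> (set es)\<inverse> = {} \<and>
        parcs (cgm_graph I) = set es \<union> (set es)\<inverse> \<and>
        w = [n, c, length ms, length es] @ ms @ map (cgm_coloring I) [0..<n] @ map fst es @ map snd es)"

section \<open>Random access machine programs\<close>

text \<open>
  Structured programs over natural-number registers and unbounded arrays. Every operation,
  including an array access at a computed index, has unit cost. Addition and truncated subtraction
  are the only arithmetic operations, so that the bit length of the largest stored number grows by
  at most a constant (depending on the program) per executed command.
\<close>

type_synonym vname = string

datatype aexp =
    N nat
  | V vname
  | Elem vname aexp
  | Plus aexp aexp
  | Minus aexp aexp

datatype bexp =
    Less aexp aexp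
  | Equal aexp aexp
  | Neg bexp
  | Conj bexp bexp

datatype com =
    Skip
  | Assign vname aexp
  | Update vname aexp aexp
  | Seq com com
  | If bexp com com
  | While bexp com

record state =
  reg :: "vname \<Rightarrow> nat"
  arr :: "vname \<Rightarrow> nat \<Rightarrow> nat"

primrec aval :: "aexp \<Rightarrow> state \<Rightarrow> nat" where
  "aval (N k) s = k"
| "aval (V x) s = reg s x"
| "aval (Elem a e) s = arr s a (aval e s)"
| "aval (Plus e1 e2) s = aval e1 s + aval e2 s"
| "aval (Minus e1 e2) s = aval e1 s - aval e2 s"

primrec bval :: "bexp \<Rightarrow> state \<Rightarrow> bool" where
  "bval (Less e1 e2) s \<longleftrightarrow> aval e1 s < aval e2 s"
| "bval (Equal e1 e2) s \<longleftrightarrow> aval e1 s = aval e2 s"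
| "bval (Neg b) s \<longleftrightarrow> \<not> bval b s"
| "bval (Conj b1 b2) s \<longleftrightarrow> bval b1 s \<and> bval b2 s"

primrec acost :: "aexp \<Rightarrow> nat" where
  "acost (N k) = 1"
| "acost (V x) = 1"
| "acost (Elem a e) = acost e + 1"
| "acost (Plus e1 e2) = acost e1 + acost e2 + 1"
| "acost (Minus e1 e2) = acost e1 + acost e2 + 1"

primrec bcost :: "bexp \<Rightarrow> nat" where
  "bcost (Less e1 e2) = acost e1 + acost e2 + 1"
| "bcost (Equal e1 e2) = acost e1 + acost e2 + 1"
| "bcost (Neg b) = bcost b + 1"
| "bcost (Conj b1 b2) = bcost b1 + bcost b2 + 1"

text \<open>\<open>exec c s t s'\<close>: started in \<open>s\<close>, the program \<open>c\<close> halts in \<open>s'\<close> after exactly \<open>t\<close> steps.\<close>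

inductive exec :: "com \<Rightarrow> state \<Rightarrow> nat \<Rightarrow> state \<Rightarrow> bool" where
  Skip: "exec Skip s 1 s"
| Assign: "exec (Assign x e) s (acost e + 1) (s\<lparr>reg := (reg s)(x := aval e s)\<rparr>)"
| Update: "exec (Update a i e) s (acost i + acost e + 1)
             (s\<lparr>arr := (arr s)(a := (arr s a)(aval i s := aval e s))\<rparr>)"
| Seq: "exec c1 s t1 s' \<Longrightarrow> exec c2 s' t2 s'' \<Longrightarrow> exec (Seq c1 c2) s (t1 + t2) s''"
| IfTrue: "bval b s \<Longrightarrow> exec c1 s t s' \<Longrightarrow> exec (If b c1 c2) s (bcost b + t + 1) s'"
| IfFalse: "\<not> bval b s \<Longrightarrow> exec c2 s t s' \<Longrightarrow> exec (If b c1 c2) s (bcost b + t + 1) s'"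
| WhileFalse: "\<not> bval b s \<Longrightarrow> exec (While b c) s (bcost b + 1) s"
| WhileTrue: "bval b s \<Longrightarrow> exec c s t1 s' \<Longrightarrow> exec (While b c) s' t2 s'' \<Longrightarrow>
    exec (While b c) s (bcost b + t1 + t2 + 1) s''"

definition init_state :: "nat list \<Rightarrow> state" where
  "init_state w =
     \<lparr>reg = (\<lambda>_. 0)(''in_len'' := length w),
      arr = (\<lambda>_ _. 0)(''in'' := (\<lambda>i. if i < length w then w ! i else 0))\<rparr>"

definition runs :: "com \<Rightarrow> nat list \<Rightarrow> nat \<Rightarrow> nat list \<Rightarrow> bool" where
  "runs P w t w' \<longleftrightarrow>
     (\<exists>s. exec P (init_state w) t s \<and> w' = map (arr s ''out'') [0..<reg s ''out_len''])"

section \<open>Problem kernels\<close>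

text \<open>
  For a parameterized problem given by its encoding relation, its yes-instances, its parameter and
  its instance size. Encodings exist only for valid instances.
\<close>

definition problem_kernel ::
    "(nat list \<Rightarrow> 'i \<Rightarrow> bool) \<Rightarrow> ('i \<Rightarrow> bool) \<Rightarrow> ('i \<Rightarrow> nat) \<Rightarrow> ('i \<Rightarrow> nat) \<Rightarrow> com \<Rightarrow> bool" where
  "problem_kernel code yes param sz P \<longleftrightarrow>
     (\<exists>a k. \<forall>w I. code w I \<longrightarrow> (\<exists>t w'. runs P w t w' \<and> t \<le> a * length w ^ k + a)) \<and>
     (\<exists>g :: nat \<Rightarrow> nat. \<forall>w I t w'. code w I \<and> runs P w t w' \<longrightarrow>
        (\<exists>I'. code w' I' \<and> (yes I' \<longleftrightarrow> yes I) \<and> sz I' \<le> g (param I)))"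

end

theory Submission
  imports Defs
begin

text \<open>
  Call a vertex unique if its colour lies in the motif and occurs nowhere else. Every solution
  contains all unique vertices, hence also the subtree \<open>T\<close> that they span. If some motif colour is
  absent, or if \<open>T\<close> contains a colour outside the motif or a repeated colour, there is no solution.
  Otherwise \<open>T\<close> is contracted to one of its vertices and the colours of the vanished vertices are
  removed from the motif. With \<open>u\<close> unique vertices, the remaining \<open>|M| - u\<close> motif colours occur at
  least twice, so \<open>|M| - u \<le> \<ell>\<close>, and at most \<open>1 + |V| - u = 1 + \<ell> + (|M| - u) \<le> 2\<ell> + 1\<close> vertices remain.
  For linear time, the tree is rooted at a unique vertex by repeatedly removing leaves; storing the
  degree and the sum of the remaining neighbours of each vertex makes adjacency lists unnecessary.
  When a vertex is removed, it is already known whether it belongs to \<open>T\<close>.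
\<close>

subsection \<open>Rooted trees\<close>

text \<open>Taking a unique vertex as root makes every test local. It lies in every solution, so it
  is the topmost vertex of each, and the spanned subtree is the set of all ancestors of unique
  vertices: a vertex belongs to \<open>T\<close> iff it is unique or has a child in
  \<open>T\<close>. Leaf removal meets all children before their parent, so membership is settled in
  time. The colour of the root stays in the motif, which keeps the contracted vertex forced. The
  colour set is a second obstacle: it may be arbitrarily large compared with \<open>n\<close>, yet
  it counts towards the kernel size, and no loop may run over it. Arrays indexed by colours
  therefore rely on their initial zeros and are touched only at colours of the motif or of vertices;
  the kept motif colours are renumbered 1, 2, ..., and all other colours collapse to 0. Without
  unique vertices \<open>T\<close> is empty, and the construction only renumbers.\<close>

lemma connected_induced_iff:
  assumes G: "pair_graph G" and S: "S \<subseteq> pverts G"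
  shows "Digraph_Component.connected (with_proj G \<restriction> S) \<longleftrightarrow>
    S \<noteq> {} \<and> (\<forall>x\<in>S. \<forall>y\<in>S. (x, y) \<in> (parcs G \<inter> S \<times> S)\<^sup>*)"
proof -
  interpret pair_graph G by (rule G)
  \<comment> \<open>\<open>connected\<close> means strong connectivity of the symmetric closure. An
    induced subgraph of a symmetric graph is symmetric already, so the closure \<open>H\<close> has
    just the arcs of \<open>G\<close> inside \<open>S\<close>.\<close>
  define H where "H = mk_symmetric (with_proj G \<restriction> S)"
  have v: "verts (with_proj H) = S"
    by (simp add: H_def mk_symmetric_def induce_subgraph_def)
  have a: "arcs_ends (with_proj H) = parcs G \<inter> S \<times> S"
    by (auto simp: H_def mk_symmetric_def induce_subgraph_def arcs_symmetric)
  have r: "x \<rightarrow>\<^sup>*\<^bsub>with_proj H\<^esub> y \<longleftrightarrow> (x, y) \<in> (parcs G \<inter> S \<times> S)\<^sup>*" if "x \<in> S" "y \<in> S" for x y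
  proof
    show "(x, y) \<in> (parcs G \<inter> S \<times> S)\<^sup>*" if "x \<rightarrow>\<^sup>*\<^bsub>with_proj H\<^esub> y"
      using that unfolding reachable_def v a by (rule rtrancl_on_rtranclI)
    assume "(x, y) \<in> (parcs G \<inter> S \<times> S)\<^sup>*"
    then show "x \<rightarrow>\<^sup>*\<^bsub>with_proj H\<^esub> y" unfolding reachable_def v a
      by (induction rule: rtrancl_induct)
         (use that in \<open>auto intro: rtrancl_on_into_rtrancl_on\<close>)
  qed
  show ?thesis
    unfolding Digraph_Component.connected_def strongly_connected_def H_def[symmetric] v
    using r by blast
qed

lemma connected_iff:
  assumes G: "pair_graph G"
  shows "Digraph_Component.connected (with_proj G) \<longleftrightarrow>
    pverts G \<noteq> {} \<and> (\<forall>x\<in>pverts G. \<forall>y\<in>pverts G. (x, y) \<in> (parcs G)\<^sup>*)"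
proof -
  interpret pair_graph G by (rule G)
  have "with_proj G \<restriction> pverts G = with_proj G"
    by (auto simp: induce_subgraph_def with_proj_def wellformed' intro!: set_eqI)
  moreover have "parcs G \<inter> pverts G \<times> pverts G = parcs G"
    by (auto simp: wellformed')
  ultimately show ?thesis using connected_induced_iff[OF G subset_refl] by simp
qed

text \<open>The strictly decreasing rank excludes cycles of \<open>par\<close> and supplies the
  induction measure; the value of \<open>par\<close> at the root is left open.\<close>

locale rooted_tree =
  fixes V :: "'v set" and r :: 'v and par :: "'v \<Rightarrow> 'v" and rk :: "'v \<Rightarrow> nat"
  assumes finite_V: "finite V" and root: "r \<in> V"
    and par_in: "\<And>v. v \<in> V \<Longrightarrow> v \<noteq> r \<Longrightarrow> par v \<in> V"
    and rk_par: "\<And>v. v \<in> V \<Longrightarrow> v \<noteq> r \<Longrightarrow> rk (par v) < rk v"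
begin

definition up :: "('v \<times> 'v) set" where
  "up = {(v, par v) | v. v \<in> V \<and> v \<noteq> r}"

definition graph :: "'v pair_pre_digraph" where
  "graph = \<lparr>pverts = V, parcs = up \<union> up\<inverse>\<rparr>"

lemma graph_simps [simp]: "pverts graph = V" "parcs graph = up \<union> up\<inverse>"
  by (simp_all add: graph_def)

lemma in_up_iff: "(u, v) \<in> up \<longleftrightarrow> u \<in> V \<and> u \<noteq> r \<and> v = par u"
  by (auto simp: up_def)

lemma up_rk: "(u, v) \<in> up \<Longrightarrow> rk v < rk u"
  by (auto simp: in_up_iff rk_par)

lemma finite_up: "finite up"
proof -
  have "up = (\<lambda>v. (v, par v)) ` (V - {r})" by (auto simp: up_def)
  then show ?thesis using finite_V by simp
qed

lemma up_disjoint: "up \<inter> up\<inverse> = {}"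
  by (auto dest!: up_rk)

lemma pair_graph: "pair_graph graph"
proof
  fix e assume e: "e \<in> parcs graph"
  obtain a b where [simp]: "e = (a, b)" by (cases e)
  show "fst e \<in> pverts graph" "snd e \<in> pverts graph" "fst e \<noteq> snd e"
    using e up_rk[of a b] up_rk[of b a] by (auto simp: in_up_iff par_in)
next
  show "Digraph.symmetric (with_proj graph)"
    by (auto simp: symmetric_def intro!: symI)
qed (simp_all add: finite_V finite_up)

lemma root_least: "v \<in> V \<Longrightarrow> v \<noteq> r \<Longrightarrow> rk r < rk v"
proof (induction "rk v" arbitrary: v rule: less_induct)
  case less
  then show ?case
    by (metis less_trans par_in rk_par)
qed

text \<open>On the way to the root, a connected set can be left only at its topmost vertex. This
  turns connectivity into a condition on single vertices and their parents, the form in which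
  solutions are handled from here on.\<close>

lemma connected_subset_iff:
  assumes S: "S \<subseteq> V"
  shows "Digraph_Component.connected (with_proj graph \<restriction> S) \<longleftrightarrow>
    (\<exists>t\<in>S. \<forall>v\<in>S - {t}. v \<noteq> r \<and> par v \<in> S)"
proof -
  let ?E = "(up \<union> up\<inverse>) \<inter> S \<times> S"
  have sym: "sym (?E\<^sup>*)" by (intro sym_rtrancl) (auto simp: sym_def)
  have "(S \<noteq> {} \<and> (\<forall>x\<in>S. \<forall>y\<in>S. (x, y) \<in> ?E\<^sup>*)) \<longleftrightarrow>
    (\<exists>t\<in>S. \<forall>v\<in>S - {t}. v \<noteq> r \<and> par v \<in> S)"
  proof
    assume "\<exists>t\<in>S. \<forall>v\<in>S - {t}. v \<noteq> r \<and> par v \<in> S"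
    then obtain t where t: "t \<in> S" "\<And>v. v \<in> S \<Longrightarrow> v \<noteq> t \<Longrightarrow> v \<noteq> r \<and> par v \<in> S" by blast
    have *: "(v, t) \<in> ?E\<^sup>*" if "v \<in> S" for v
      using that
    proof (induction "rk v" arbitrary: v rule: less_induct)
      case less
      show ?case
      proof (cases "v = t")
        case False
        then have "(v, par v) \<in> ?E" "rk (par v) < rk v" "par v \<in> S"
          using t(2) less.prems S rk_par by (auto simp: in_up_iff)
        then show ?thesis using less.hyps by (meson converse_rtrancl_into_rtrancl)
      qed simp
    qed
    show "S \<noteq> {} \<and> (\<forall>x\<in>S. \<forall>y\<in>S. (x, y) \<in> ?E\<^sup>*)"
      using * t(1) sym by (metis empty_iff rtrancl_trans symD)
  next
    assume con: "S \<noteq> {} \<and> (\<forall>x\<in>S. \<forall>y\<in>S. (x, y) \<in> ?E\<^sup>*)"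
    then obtain t where t: "t \<in> S" "\<And>v. v \<in> S \<Longrightarrow> rk t \<le> rk v"
      using ex_has_least_nat[of "\<lambda>v. v \<in> S" _ rk] by blast
    have "v \<noteq> r \<and> par v \<in> S" if v: "v \<in> S" "v \<noteq> t" for v
    proof
      show "v \<noteq> r" using root_least[of t] t(1) t(2)[OF v(1)] S v by fastforce
      show "par v \<in> S"
      proof (rule ccontr)
        assume out: "par v \<notin> S"
        \<comment> \<open>The descendants of \<open>v\<close> inside \<open>S\<close> form a component that misses \<open>t\<close>.\<close>
        have "(v, x) \<in> ?E\<^sup>* \<Longrightarrow> (x, v) \<in> (up \<inter> S \<times> S)\<^sup>*" for x
        proof (induction rule: rtrancl_induct)
          case (step y z)
          then consider "(y, z) \<in> up \<inter> S \<times> S" | "(z, y) \<in> up \<inter> S \<times> S" by blast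
          then show ?case
          proof cases
            case 1
            \<comment> \<open>The walk climbs from \<open>y\<close> to \<open>z = par y\<close>. If
              \<open>y = v\<close>, it would leave \<open>S\<close>; otherwise the upward chain from
              \<open>y\<close> to \<open>v\<close> starts with this very step, which is
              dropped.\<close>
            from step.IH show ?thesis
            proof (cases rule: converse_rtranclE)
              case base then show ?thesis using 1 out by (auto simp: in_up_iff)
            next
              case (step y') then show ?thesis using 1 by (auto simp: in_up_iff)
            qed
          next
            case 2 then show ?thesis using step.IH by (meson converse_rtrancl_into_rtrancl)
          qed
        qed simp
        \<comment> \<open>By \<open>con\<close> the claim applies to \<open>t\<close>, so
          \<open>t\<close> would lie below \<open>v\<close>, although its rank is least.\<close>
        then have "(t, v) \<in> (up \<inter> S \<times> S)\<^sup>*" using con t v by blast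
        then show False
        proof (cases rule: rtranclE)
          case base then show ?thesis using v by simp
        next
          case (step y)
          have "(x, y) \<in> (up \<inter> S \<times> S)\<^sup>* \<Longrightarrow> rk y \<le> rk x" for x y
            by (induction rule: rtrancl_induct) (auto dest!: up_rk)
          then have "rk v < rk t" using step up_rk by fastforce
          then show False using t(2) v by (meson leD)
        qed
      qed
    qed
    then show "\<exists>t\<in>S. \<forall>v\<in>S - {t}. v \<noteq> r \<and> par v \<in> S" using t(1) by blast
  qed
  then show ?thesis using connected_induced_iff[OF pair_graph, of S] S by simp
qed

text \<open>Both neighbours on a cycle of a vertex of maximal rank would have to be its parent.
  Length at least 3 makes these neighbours distinct.\<close>

lemma acyclic: "\<not> (pre_digraph.cycle (with_proj graph) p \<and> 3 \<le> length p)"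
proof
  interpret pair_graph graph by (rule pair_graph)
  assume "cycle p \<and> 3 \<le> length p"
  then obtain u where len: "3 \<le> length p" and w: "set p \<subseteq> parcs graph" "pcas u p u"
    and dist: "distinct (tl (pawalk_verts u p))"
    unfolding cycle_def awalk_def by auto
  have tl: "tl (pawalk_verts u p) = map snd p"
    using awalk_verts_conv'[OF w(2)] len by (auto split: if_splits)
  have link: "pcas a q b \<Longrightarrow> (\<forall>i. Suc i < length q \<longrightarrow> fst (q ! Suc i) = snd (q ! i)) \<and>
      (q \<noteq> [] \<longrightarrow> fst (q ! 0) = a \<and> snd (last q) = b)" for a q b
  proof (induction q arbitrary: a)
    case (Cons e q)
    have c: "fst e = a" "pcas (snd e) q b" using Cons.prems by auto
    note IH = Cons.IH[OF c(2)]
    show ?case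
    proof (intro conjI allI impI)
      fix i assume "Suc i < length (e # q)"
      then show "fst ((e # q) ! Suc i) = snd ((e # q) ! i)"
        using IH by (cases i) auto
    qed (use c IH in auto)
  qed simp
  \<comment> \<open>Positions are read cyclically: \<open>x i\<close> is the head of arc
    \<open>i\<close> and \<open>nx i\<close> the next position, so arc \<open>nx i\<close> runs from
    \<open>x i\<close> to \<open>x (nx i)\<close>.\<close>
  define L where "L = length p"
  define x where "x i = snd (p ! i)" for i
  define nx where "nx i = (if Suc i < L then Suc i else 0)" for i
  have L: "3 \<le> L" using len by (simp add: L_def)
  have step: "p ! nx i = (x i, x (nx i))" if "i < L" for i
  proof -
    have "fst (p ! nx i) = x i"
    proof (cases "Suc i < L")
      case True then show ?thesis using link[OF w(2)] by (simp add: nx_def x_def L_def)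
    next
      case False
      then have "i = L - 1" using that by simp
      then have "x i = snd (last p)" using L by (subst last_conv_nth) (auto simp: L_def x_def)
      moreover have "p \<noteq> []" using len by auto
      ultimately show ?thesis using link[OF w(2)] False by (simp add: nx_def)
    qed
    then show ?thesis by (simp add: x_def prod_eq_iff)
  qed
  have nx: "nx i < L" for i using L by (auto simp: nx_def)
  have inj: "x i \<noteq> x j" if "i < L" "j < L" "i \<noteq> j" for i j
    using dist that unfolding tl by (auto simp: distinct_conv_nth L_def x_def)
  have adj: "(x i, x (nx i)) \<in> up \<or> (x (nx i), x i) \<in> up" if "i < L" for i
    using w(1) step[OF that] nx[of i] by (auto simp: L_def dest!: nth_mem)
  obtain j where j: "j < L" "\<And>i. i < L \<Longrightarrow> rk (x i) \<le> rk (x j)"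
  proof -
    have "finite ((\<lambda>i. rk (x i)) ` {..<L})" "(\<lambda>i. rk (x i)) ` {..<L} \<noteq> {}"
      using L by (auto simp: lessThan_empty_iff)
    from Max_in[OF this] Max_ge[OF this(1)] that show ?thesis by fastforce
  qed
  define k where "k = (if j = 0 then L - 1 else j - 1)"
  have k: "k < L" "nx k = j" using j L by (auto simp: k_def nx_def)
  have "(x j, x (nx j)) \<in> up" using adj[OF j(1)] j(2)[OF nx] up_rk by (meson leD)
  moreover have "(x j, x k) \<in> up" using adj[OF k(1)] j(2)[OF k(1)] up_rk k(2) by (metis leD)
  ultimately have "x (nx j) = x k" by (simp add: in_up_iff)
  moreover have "nx j \<noteq> k" using j L by (auto simp: k_def nx_def)
  ultimately show False using inj nx k by blast
qed

lemma undirected_tree: "undirected_tree graph"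
proof -
  have "\<exists>t\<in>V. \<forall>v\<in>V - {t}. v \<noteq> r \<and> par v \<in> V" using root par_in by blast
  then have "Digraph_Component.connected (with_proj graph \<restriction> V)"
    by (simp add: connected_subset_iff)
  moreover have "(up \<union> up\<inverse>) \<inter> V \<times> V = up \<union> up\<inverse>" by (auto simp: in_up_iff par_in)
  ultimately have "Digraph_Component.connected (with_proj graph)"
    using connected_induced_iff[OF pair_graph, of V] connected_iff[OF pair_graph] by simp
  then show ?thesis unfolding undirected_tree_def using pair_graph acyclic by blast
qed

end

text \<open>The rooted subtree grows one vertex at a time. A new vertex with two neighbours in the subtree
  would close a cycle, and insertion times serve as ranks.\<close>

lemma undirected_tree_rooted:
  fixes G :: "'v pair_pre_digraph"
  assumes tree: "undirected_tree G" and r: "r \<in> pverts G"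
  obtains par rk where "rooted_tree (pverts G) r par rk"
    "parcs G = rooted_tree.up (pverts G) r par \<union> (rooted_tree.up (pverts G) r par)\<inverse>"
proof -
  interpret pair_graph G using tree by (simp add: undirected_tree_def)
  have con: "\<And>x y. x \<in> pverts G \<Longrightarrow> y \<in> pverts G \<Longrightarrow> (x, y) \<in> (parcs G)\<^sup>*"
    using tree connected_iff[OF pair_graph] by (simp add: undirected_tree_def)
  have acyc: "\<And>p. cycle p \<Longrightarrow> length p < 3"
    using tree by (auto simp: undirected_tree_def not_le[symmetric])
  let ?up = "\<lambda>X par. {(v, par v) | v. v \<in> X \<and> v \<noteq> r}"
  \<comment> \<open>The path conjunct keeps any two vertices of \<open>X\<close> joined by a simple
    path inside \<open>X\<close>, which a second neighbour of a new vertex would close to a cycle.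
    Ranks below \<open>card X\<close> leave \<open>card X\<close> free as the rank of the next
    vertex.\<close>
  have grow: "\<exists>X par rk. X \<subseteq> pverts G \<and> r \<in> X \<and> card X = Suc k \<and>
      (\<forall>v\<in>X - {r}. par v \<in> X \<and> (rk (par v) :: nat) < rk v) \<and> (\<forall>v\<in>X. rk v < card X) \<and>
      parcs G \<inter> X \<times> X = ?up X par \<union> (?up X par)\<inverse> \<and>
      (\<forall>x\<in>X. \<forall>y\<in>X. \<exists>p. apath x p y \<and> set (pawalk_verts x p) \<subseteq> X)"
    if "Suc k \<le> card (pverts G)" for k
    using that
  proof (induction k)
    case 0
    have "parcs G \<inter> {r} \<times> {r} = {}" by (auto dest: no_loops')
    moreover have "apath r [] r" using r by (simp add: apath_Nil_iff)
    ultimately show ?case using r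
      by (intro exI[of _ "{r}"] exI[of _ "\<lambda>v. v"] exI[of _ "\<lambda>v. 0"])
         (auto intro!: exI[of _ "[]"])
  next
    case (Suc k)
    then have "Suc k \<le> card (pverts G)" by simp
    from Suc.IH[OF this] obtain X par rk where IH: "X \<subseteq> pverts G \<and> r \<in> X \<and> card X = Suc k \<and>
      (\<forall>v\<in>X - {r}. par v \<in> X \<and> (rk (par v) :: nat) < rk v) \<and> (\<forall>v\<in>X. rk v < card X) \<and>
      parcs G \<inter> X \<times> X = ?up X par \<union> (?up X par)\<inverse> \<and>
      (\<forall>x\<in>X. \<forall>y\<in>X. \<exists>p. apath x p y \<and> set (pawalk_verts x p) \<subseteq> X)"
      by (elim exE)
    then have X: "X \<subseteq> pverts G" "r \<in> X" "card X = Suc k"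
      and par: "\<And>v. v \<in> X \<Longrightarrow> v \<noteq> r \<Longrightarrow> par v \<in> X"
               "\<And>v. v \<in> X \<Longrightarrow> v \<noteq> r \<Longrightarrow> (rk (par v) :: nat) < rk v"
      and rk: "\<And>v. v \<in> X \<Longrightarrow> rk v < card X"
      by auto
    have arcs: "parcs G \<inter> X \<times> X = ?up X par \<union> (?up X par)\<inverse>"
      using IH by (elim conjE)
    have path: "\<And>x y. x \<in> X \<Longrightarrow> y \<in> X \<Longrightarrow> \<exists>p. apath x p y \<and> set (pawalk_verts x p) \<subseteq> X"
      using IH by simp
    have finX: "finite X" using X pair_finite_verts finite_subset by blast
    obtain z where z: "z \<in> pverts G" "z \<notin> X"
      using X Suc.prems by (metis Suc_n_not_le_n subsetI subset_antisym)
    \<comment> \<open>A walk from \<open>r\<close> to a vertex outside \<open>X\<close> crosses some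
      arc that leaves \<open>X\<close>.\<close>
    have "(r, y) \<in> (parcs G)\<^sup>* \<Longrightarrow> y \<notin> X \<Longrightarrow> \<exists>a b. (a, b) \<in> parcs G \<and> a \<in> X \<and> b \<notin> X" for y
      by (induction rule: rtrancl_induct) (use X in auto)
    then obtain x y where xy: "(x, y) \<in> parcs G" "x \<in> X" "y \<notin> X" using con z r by blast
    have uniq: "x' = x" if x': "(x', y) \<in> parcs G" "x' \<in> X" for x'
    proof (rule ccontr)
      assume ne: "x' \<noteq> x"
      obtain p where p: "apath x p x'" "set (pawalk_verts x p) \<subseteq> X" using path xy x' by blast
      \<comment> \<open>A nonempty \<open>p\<close> gives the closed walk at least three arcs, as a
        forbidden cycle must have.\<close>
      have pne: "p \<noteq> []" using p ne by (auto simp: apath_def awalk_def)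
      have w: "awalk x p x'" "distinct (pawalk_verts x p)" using p by (auto simp: apath_def)
      have a1: "awalk y [(y, x)] x" and a2: "awalk x' [(x', y)] y"
        using xy x' by (auto simp: awalk_def arcs_symmetric wellformed')
      have walk: "awalk y ([(y, x)] @ p @ [(x', y)]) y"
        using awalk_appendI[OF a1 awalk_appendI[OF w(1) a2]] .
      have "pawalk_verts x (p @ [(x', y)]) = pawalk_verts x p @ [y]"
        using awalk_verts_append[OF awalk_appendI[OF w(1) a2]] by simp
      then have "distinct (tl (pawalk_verts y ([(y, x)] @ p @ [(x', y)])))"
        using w(2) p(2) xy(3) by auto
      then have "cycle ([(y, x)] @ p @ [(x', y)])" using walk by (auto simp: cycle_def)
      from acyc[OF this] pne show False by (cases p) auto
    qed
    let ?X = "insert y X" and ?par = "par(y := x)" and ?rk = "rk(y := card X)"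
    have yr: "y \<noteq> r" using X xy by blast
    have new: "parcs G \<inter> ?X \<times> ?X = parcs G \<inter> X \<times> X \<union> {(x, y), (y, x)}"
    proof (intro set_eqI iffI)
      fix e assume e: "e \<in> parcs G \<inter> ?X \<times> ?X"
      obtain a b where ab: "e = (a, b)" by (cases e)
      have "a \<noteq> b" "(b, a) \<in> parcs G" using e ab no_loops' arcs_symmetric by auto
      then show "e \<in> parcs G \<inter> X \<times> X \<union> {(x, y), (y, x)}"
        using e ab uniq by auto
    next
      fix e assume "e \<in> parcs G \<inter> X \<times> X \<union> {(x, y), (y, x)}"
      then show "e \<in> parcs G \<inter> ?X \<times> ?X" using xy arcs_symmetric[OF xy(1)] by auto
    qed
    have up': "?up ?X ?par = ?up X par \<union> {(y, x)}" using xy yr by auto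
    have arcs': "parcs G \<inter> ?X \<times> ?X = ?up ?X ?par \<union> (?up ?X ?par)\<inverse>"
      unfolding new up' arcs by auto
    have to: "\<exists>p. apath y p a \<and> set (pawalk_verts y p) \<subseteq> ?X" if a: "a \<in> X" for a
    proof -
      obtain p where p: "apath x p a" "set (pawalk_verts x p) \<subseteq> X" using path xy a by blast
      then have "apath y ((y, x) # p) a"
        using xy by (auto simp: apath_def awalk_Cons_iff arcs_symmetric)
      then show ?thesis using p by (intro exI[of _ "(y, x) # p"]) auto
    qed
    have fro: "\<exists>p. apath a p y \<and> set (pawalk_verts a p) \<subseteq> ?X" if a: "a \<in> X" for a
    proof -
      obtain p where p: "apath y p a" "set (pawalk_verts y p) \<subseteq> ?X" using to[OF a] by blast
      then have "pawalk_verts a (rev_path p) = rev (pawalk_verts y p)"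
        using awalk_verts_rev_path[of y p a] by (simp add: apath_def)
      then show ?thesis using p by (intro exI[of _ "rev_path p"]) simp
    qed
    have self: "apath y [] y" using xy by (simp add: apath_Nil_iff wellformed')
    have path': "\<exists>p. apath a p b \<and> set (pawalk_verts a p) \<subseteq> ?X" if "a \<in> ?X" "b \<in> ?X" for a b
    proof -
      consider "a \<in> X" "b \<in> X" | "a = y" "b \<in> X" | "a \<in> X" "b = y" | "a = y" "b = y"
        using \<open>a \<in> ?X\<close> \<open>b \<in> ?X\<close> by blast
      then show ?thesis
      proof cases
        case 1 then show ?thesis using path[of a b] by blast
      next
        case 4 then show ?thesis using self by (intro exI[of _ "[]"]) auto
      qed (use to fro in auto)
    qed
    show ?case
    proof (intro exI[of _ ?X] exI[of _ ?par] exI[of _ ?rk] conjI ballI)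
      show "?X \<subseteq> pverts G" using X xy wellformed' by blast
      show "card ?X = Suc (Suc k)" using X finX xy by simp
      show "?par v \<in> ?X" if "v \<in> ?X - {r}" for v using that par xy by auto
      show "?rk (?par v) < ?rk v" if "v \<in> ?X - {r}" for v
      proof (cases "v = y")
        case True then show ?thesis using rk xy by auto
      next
        case False
        then have "v \<in> X" "v \<noteq> r" using that by auto
        then have "par v \<noteq> y" "rk (par v) < rk v" using par xy by auto
        then show ?thesis using False by simp
      qed
      show "?rk v < card ?X" if "v \<in> ?X" for v
        using that rk[of v] finX xy by auto
      show "parcs G \<inter> ?X \<times> ?X = ?up ?X ?par \<union> (?up ?X ?par)\<inverse>" by (rule arcs')
    qed (use X path' in auto)
  qed
  have pos: "card (pverts G) > 0" using r pair_finite_verts by (auto simp: card_gt_0_iff)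
  then have "Suc (card (pverts G) - 1) \<le> card (pverts G)" by simp
  from grow[OF this] pos obtain X par rk where X: "X \<subseteq> pverts G" "card X = card (pverts G)"
    and P: "\<forall>v\<in>X - {r}. par v \<in> X \<and> (rk (par v) :: nat) < rk v"
    and arcs: "parcs G \<inter> X \<times> X = ?up X par \<union> (?up X par)\<inverse>"
    by (elim exE conjE) simp
  have XV: "X = pverts G" using X pair_finite_verts card_subset_eq by blast
  have "parcs G \<inter> X \<times> X = parcs G" unfolding XV using wellformed' by auto
  moreover have rt: "rooted_tree (pverts G) r par rk"
    using P r pair_finite_verts unfolding XV by unfold_locales auto
  ultimately show ?thesis using that[of par rk] arcs rooted_tree.up_def[OF rt] XV by simp
qed

subsection \<open>Verification of random access machine programs\<close>

inductive_cases exec_elims: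
  "exec Skip s t s'" "exec (Assign x e) s t s'" "exec (Update a i e) s t s'"
  "exec (Seq c1 c2) s t s'" "exec (If b c1 c2) s t s'" "exec (While b c) s t s'"

text \<open>The kernel property speaks about every run on an input word, while the verification
  constructs one run; determinism identifies them.\<close>

lemma exec_det: "exec c s t s' \<Longrightarrow> exec c s u s2 \<Longrightarrow> u = t \<and> s2 = s'"
proof (induction arbitrary: u s2 rule: exec.induct)
  case (Seq c1 s t1 s' c2 t2 s'')
  from Seq.prems obtain a v b where "exec c1 s a v" "exec c2 v b s2" "u = a + b"
    by (auto elim: exec_elims(4))
  then show ?case using Seq.IH by metis
next
  case (WhileTrue b s c t1 s' t2 s'')
  from WhileTrue.prems WhileTrue.hyps(1) obtain a v d
    where "exec c s a v" "exec (While b c) v d s2" "u = bcost b + a + d + 1"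
    by (auto elim: exec_elims(6))
  then show ?case using WhileTrue.IH by metis
next
  case (IfTrue b s c1 t s' c2)
  from IfTrue.prems IfTrue.hyps(1) obtain a where "exec c1 s a s2" "u = bcost b + a + 1"
    by (auto elim: exec_elims(5))
  then show ?case using IfTrue.IH by metis
next
  case (IfFalse b s c2 t s' c1)
  from IfFalse.prems IfFalse.hyps(1) obtain a where "exec c2 s a s2" "u = bcost b + a + 1"
    by (auto elim: exec_elims(5))
  then show ?case using IfFalse.IH by metis
next
  case (WhileFalse b s c)
  then show ?case by (auto elim: exec_elims(6))
qed (auto elim: exec_elims(1,2,3))

primrec loopfree :: "com \<Rightarrow> bool" where
  "loopfree Skip \<longleftrightarrow> True"
| "loopfree (Assign x e) \<longleftrightarrow> True"
| "loopfree (Update a i e) \<longleftrightarrow> True"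
| "loopfree (Seq c1 c2) \<longleftrightarrow> loopfree c1 \<and> loopfree c2"
| "loopfree (If b c1 c2) \<longleftrightarrow> loopfree c1 \<and> loopfree c2"
| "loopfree (While b c) \<longleftrightarrow> False"

text \<open>Loop-free code is executed symbolically by rewriting, so that loop bodies need no
  derivations in \<open>exec\<close>.\<close>

primrec run :: "com \<Rightarrow> state \<Rightarrow> state" where
  "run Skip s = s"
| "run (Assign x e) s = s\<lparr>reg := (reg s)(x := aval e s)\<rparr>"
| "run (Update a i e) s = s\<lparr>arr := (arr s)(a := (arr s a)(aval i s := aval e s))\<rparr>"
| "run (Seq c1 c2) s = run c2 (run c1 s)"
| "run (If b c1 c2) s = (if bval b s then run c1 s else run c2 s)"
| "run (While b c) s = s"

text \<open>Adding up both branches of a conditional and counting one round of a loop makes the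
  weight depend on the program text only. It is thus a constant in the final time bound.\<close>

primrec weight :: "com \<Rightarrow> nat" where
  "weight Skip = 1"
| "weight (Assign x e) = acost e + 1"
| "weight (Update a i e) = acost i + acost e + 1"
| "weight (Seq c1 c2) = weight c1 + weight c2"
| "weight (If b c1 c2) = bcost b + weight c1 + weight c2 + 1"
| "weight (While b c) = bcost b + weight c + 1"

primrec rmod :: "com \<Rightarrow> vname set" where
  "rmod Skip = {}"
| "rmod (Assign x e) = {x}"
| "rmod (Update a i e) = {}"
| "rmod (Seq c1 c2) = rmod c1 \<union> rmod c2"
| "rmod (If b c1 c2) = rmod c1 \<union> rmod c2"
| "rmod (While b c) = rmod c"

primrec amod :: "com \<Rightarrow> vname set" where
  "amod Skip = {}"
| "amod (Assign x e) = {}"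
| "amod (Update a i e) = {a}"
| "amod (Seq c1 c2) = amod c1 \<union> amod c2"
| "amod (If b c1 c2) = amod c1 \<union> amod c2"
| "amod (While b c) = amod c"

text \<open>Loop invariants need to mention only what the loop changes; facts on all other registers
  and arrays are transported by this relation.\<close>

definition frame :: "com \<Rightarrow> state \<Rightarrow> state \<Rightarrow> bool" where
  "frame c s s' \<longleftrightarrow> (\<forall>x. x \<notin> rmod c \<longrightarrow> reg s' x = reg s x) \<and> (\<forall>a. a \<notin> amod c \<longrightarrow> arr s' a = arr s a)"

lemma frame_reg: "frame c s s' \<Longrightarrow> x \<notin> rmod c \<Longrightarrow> reg s' x = reg s x"
  and frame_arr: "frame c s s' \<Longrightarrow> a \<notin> amod c \<Longrightarrow> arr s' a = arr s a"
  by (simp_all add: frame_def)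

lemma exec_frame: "exec c s t s' \<Longrightarrow> frame c s s'"
  by (induction rule: exec.induct) (auto simp: frame_def)

lemma run_exec: "loopfree c \<Longrightarrow> \<exists>t\<le>weight c. exec c s t (run c s)"
proof (induction c arbitrary: s)
  case (Seq c1 c2)
  obtain t1 where t1: "t1 \<le> weight c1" "exec c1 s t1 (run c1 s)" using Seq by auto
  obtain t2 where t2: "t2 \<le> weight c2" "exec c2 (run c1 s) t2 (run c2 (run c1 s))" using Seq by auto
  show ?case using exec.Seq[OF t1(2) t2(2)] t1(1) t2(1) by (intro exI[of _ "t1 + t2"]) simp
next
  case (If b c1 c2)
  obtain t1 where t1: "t1 \<le> weight c1" "exec c1 s t1 (run c1 s)" using If by auto
  obtain t2 where t2: "t2 \<le> weight c2" "exec c2 s t2 (run c2 s)" using If by auto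
  show ?case
  proof (cases "bval b s")
    case True
    then show ?thesis using exec.IfTrue[OF True t1(2), of c2] t1(1)
      by (intro exI[of _ "bcost b + t1 + 1"]) simp
  next
    case False
    then show ?thesis using exec.IfFalse[OF False t2(2), of c1] t2(1)
      by (intro exI[of _ "bcost b + t2 + 1"]) simp
  qed
qed (auto intro: exec.intros simp del: One_nat_def)

lemma run_frame: "loopfree c \<Longrightarrow> frame c s (run c s)"
  using run_exec exec_frame by blast

text \<open>If no loop of \<open>c\<close> makes more than \<open>K\<close> iterations and loops are not nested, then \<open>c\<close> takes at
  most \<open>weight c * (K + 1)\<close> steps.\<close>

definition ok :: "nat \<Rightarrow> com \<Rightarrow> state \<Rightarrow> (state \<Rightarrow> bool) \<Rightarrow> bool" where
  "ok K c s Q \<longleftrightarrow> (\<exists>t s'. exec c s t s' \<and> t \<le> weight c * (K + 1) \<and> Q s')"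

lemma ok_run:
  assumes "loopfree c" "Q (run c s)"
  shows "ok K c s Q"
proof -
  obtain t where "t \<le> weight c" "exec c s t (run c s)" using run_exec assms(1) by blast
  moreover have "weight c \<le> weight c * (K + 1)" by simp
  ultimately show ?thesis unfolding ok_def using assms(2) le_trans by blast
qed

lemma ok_Seq:
  assumes "ok K c1 s Q1" "\<And>s1. frame c1 s s1 \<Longrightarrow> Q1 s1 \<Longrightarrow> ok K c2 s1 Q"
  shows "ok K (Seq c1 c2) s Q"
proof -
  obtain t1 s1 where 1: "exec c1 s t1 s1" "t1 \<le> weight c1 * (K + 1)" "Q1 s1"
    using assms(1) by (auto simp: ok_def)
  obtain t2 s2 where 2: "exec c2 s1 t2 s2" "t2 \<le> weight c2 * (K + 1)" "Q s2"
    using assms(2)[OF exec_frame[OF 1(1)] 1(3)] by (auto simp: ok_def)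
  have "t1 + t2 \<le> weight (Seq c1 c2) * (K + 1)" using 1(2) 2(2) by (simp add: algebra_simps)
  then show ?thesis unfolding ok_def using exec.Seq[OF 1(1) 2(1)] 2(3) by blast
qed

lemma ok_If:
  assumes "bval b s \<Longrightarrow> ok K c1 s Q" "\<not> bval b s \<Longrightarrow> ok K c2 s Q"
  shows "ok K (If b c1 c2) s Q"
proof (cases "bval b s")
  case True
  then obtain t s' where t: "exec c1 s t s'" "t \<le> weight c1 * (K + 1)" "Q s'"
    using assms(1) by (auto simp: ok_def)
  have "bcost b + t + 1 \<le> weight (If b c1 c2) * (K + 1)" using t(2) by (simp add: algebra_simps)
  then show ?thesis unfolding ok_def using exec.IfTrue[OF True t(1)] t(3) by blast
next
  case False
  then obtain t s' where t: "exec c2 s t s'" "t \<le> weight c2 * (K + 1)" "Q s'"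
    using assms(2) by (auto simp: ok_def)
  have "bcost b + t + 1 \<le> weight (If b c1 c2) * (K + 1)" using t(2) by (simp add: algebra_simps)
  then show ?thesis unfolding ok_def using exec.IfFalse[OF False t(1)] t(3) by blast
qed

text \<open>The first argument of \<open>I\<close> bounds the remaining rounds and drops in each
  one. The final failing test pays for the extra unit in \<open>k + 1\<close>.\<close>

lemma exec_While:
  assumes "loopfree c" "I k s"
    and step: "\<And>k s. I k s \<Longrightarrow> bval b s \<Longrightarrow> \<exists>j<k. I j (run c s)"
  shows "\<exists>t s' j. exec (While b c) s t s' \<and> t \<le> weight (While b c) * (k + 1) \<and> I j s' \<and> \<not> bval b s'"
  using assms(2)
proof (induction k arbitrary: s rule: less_induct)
  case (less k)
  show ?case
  proof (cases "bval b s")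
    case False
    show ?thesis
      using exec.WhileFalse[OF False, of c] less.prems False
      by (intro exI[of _ "bcost b + 1"] exI[of _ s] exI[of _ k]) simp
  next
    case True
    then obtain j where j: "j < k" "I j (run c s)" using step less.prems by blast
    obtain t1 where t1: "t1 \<le> weight c" "exec c s t1 (run c s)" using run_exec assms(1) by blast
    obtain t s' i where t: "exec (While b c) (run c s) t s'" "t \<le> weight (While b c) * (j + 1)"
      "I i s'" "\<not> bval b s'" using less.IH[OF j] by blast
    have "weight (While b c) * (j + 1) \<le> weight (While b c) * k"
      using j(1) by (intro mult_le_mono) simp_all
    then have "bcost b + t1 + t + 1 \<le> weight (While b c) * (k + 1)"
      using t1(1) t(2) by (simp add: algebra_simps)
    then show ?thesis using exec.WhileTrue[OF True t1(2) t(1)] t(3,4) by blast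
  qed
qed

text \<open>The frame condition is carried along with the invariant, so that \<open>step\<close> and
  \<open>fin\<close> can use what held before the loop.\<close>

lemma ok_While:
  assumes "loopfree c" "I k s" "k \<le> K"
    and step: "\<And>k s'. I k s' \<Longrightarrow> frame c s s' \<Longrightarrow> bval b s' \<Longrightarrow> \<exists>j<k. I j (run c s')"
    and fin: "\<And>k s'. I k s' \<Longrightarrow> frame c s s' \<Longrightarrow> \<not> bval b s' \<Longrightarrow> Q s'"
  shows "ok K (While b c) s Q"
proof -
  have "\<exists>j<k. I j (run c s') \<and> frame c s (run c s')"
    if "I k s' \<and> frame c s s'" "bval b s'" for k s'
    using that step[of k s'] run_frame[OF assms(1), of s'] by (fastforce simp: frame_def)
  from exec_While[OF assms(1), of "\<lambda>k s'. I k s' \<and> frame c s s'" k s b, OF _ this] assms(2)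
  obtain t s' j where t: "exec (While b c) s t s'" "t \<le> weight (While b c) * (k + 1)"
    "I j s'" "frame c s s'" "\<not> bval b s'" by (auto simp: frame_def)
  have "weight (While b c) * (k + 1) \<le> weight (While b c) * (K + 1)"
    using assms(3) by (intro mult_le_mono) simp_all
  then show ?thesis unfolding ok_def using t fin by (meson le_trans)
qed

definition For :: "vname \<Rightarrow> vname \<Rightarrow> com \<Rightarrow> com" where
  "For x y c = Seq (Assign x (N 0)) (While (Less (V x) (V y)) (Seq c (Assign x (Plus (V x) (N 1)))))"

lemma mod_For [simp]: "rmod (For x y c) = insert x (rmod c)" "amod (For x y c) = amod c"
  by (auto simp: For_def)

text \<open>By \<open>inv\<close> the invariant does not depend on the counter register, hence it
  survives the reset and the increments; \<open>reg s y - reg s' x\<close> rounds are left.\<close>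

lemma ok_For:
  assumes "loopfree c" "x \<notin> rmod c" "y \<notin> rmod c" "x \<noteq> y" "reg s y \<le> K"
    and inv: "\<And>i s' k. I i (s'\<lparr>reg := (reg s')(x := k)\<rparr>) = I i s'"
    and base: "I 0 s"
    and step: "\<And>i s'. frame (For x y c) s s' \<Longrightarrow> i < reg s y \<Longrightarrow> reg s' x = i \<Longrightarrow> I i s' \<Longrightarrow> I (Suc i) (run c s')"
    and fin: "\<And>s'. frame (For x y c) s s' \<Longrightarrow> I (reg s y) s' \<Longrightarrow> Q s'"
  shows "ok K (For x y c) s Q"
  unfolding For_def
proof (rule ok_Seq)
  let ?s0 = "s\<lparr>reg := (reg s)(x := 0)\<rparr>" and ?c = "Seq c (Assign x (Plus (V x) (N 1)))"
  show "ok K (Assign x (N 0)) s (\<lambda>s'. s' = ?s0)" by (rule ok_run) auto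
  fix s1 assume [simp]: "s1 = ?s0"
  let ?I = "\<lambda>k s'. reg s' x \<le> reg s y \<and> k = reg s y - reg s' x \<and> I (reg s' x) s'"
  have fr: "frame (For x y c) s s'" if "frame ?c s1 s'" for s'
    using that by (auto simp: frame_def)
  show "ok K (While (Less (V x) (V y)) ?c) s1 Q"
  proof (rule ok_While[where I = ?I and k = "reg s y"])
    fix k s' assume I: "?I k s'" and f: "frame ?c s1 s'" and b: "bval (Less (V x) (V y)) s'"
    have y: "reg s' y = reg s y" using f assms(3,4) by (auto simp: frame_def)
    have "I (Suc (reg s' x)) (run c s')"
      using step[OF fr[OF f] _ refl] I b y by simp
    moreover have "reg (run c s') x = reg s' x"
      using run_frame[OF assms(1)] assms(2) by (simp add: frame_def)
    ultimately show "\<exists>j<k. ?I j (run ?c s')" using I b y inv by auto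
  next
    fix k s' assume I: "?I k s'" and f: "frame ?c s1 s'" and b: "\<not> bval (Less (V x) (V y)) s'"
    have y: "reg s' y = reg s y" using f assms(3,4) by (auto simp: frame_def)
    then show "Q s'" using fin[OF fr[OF f]] I b by (auto simp: not_less)
  qed (use assms(1,5) inv[of 0 s 0] base in auto)
qed

subsection \<open>Contraction of the forced subtree\<close>

definition pos :: "'a list \<Rightarrow> 'a \<Rightarrow> nat" where
  "pos xs x = length (takeWhile (\<lambda>y. y \<noteq> x) xs)"

lemma pos_less: "x \<in> set xs \<Longrightarrow> pos xs x < length xs"
  by (induction xs) (auto simp: pos_def)

lemma nth_pos: "x \<in> set xs \<Longrightarrow> xs ! pos xs x = x"
  by (induction xs) (auto simp: pos_def)

lemma pos_nth: "distinct xs \<Longrightarrow> i < length xs \<Longrightarrow> pos xs (xs ! i) = i"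
  by (metis distinct_conv_nth nth_mem nth_pos pos_less)

lemma pos_append: "x \<notin> set xs \<Longrightarrow> pos (xs @ x # ys) x = length xs"
  by (induction xs) (auto simp: pos_def)

text \<open>Connectivity is expressed as in \<open>connected_subset_iff\<close>, and the required
  bijection onto the motif can only be the colouring itself.\<close>

definition rooted_solution ::
    "nat \<Rightarrow> nat \<Rightarrow> (nat \<Rightarrow> nat) \<Rightarrow> (nat \<Rightarrow> nat) \<Rightarrow> nat set \<Rightarrow> nat set \<Rightarrow> bool" where
  "rooted_solution n r par chi M S \<longleftrightarrow> S \<subseteq> {0..<n} \<and>
     (\<exists>t\<in>S. \<forall>v\<in>S - {t}. v \<noteq> r \<and> par v \<in> S) \<and> inj_on chi S \<and> chi ` S = M"

definition unique_verts :: "nat \<Rightarrow> (nat \<Rightarrow> nat) \<Rightarrow> nat set \<Rightarrow> nat set" where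
  "unique_verts n chi M = {v. v < n \<and> chi v \<in> M \<and> (\<forall>u<n. chi u = chi v \<longrightarrow> u = v)}"

locale rooted_motif = rooted_tree "{0..<n}" r par rk
  for n :: nat and r :: nat and par :: "nat \<Rightarrow> nat" and rk :: "nat \<Rightarrow> nat" +
  fixes chi :: "nat \<Rightarrow> nat" and ms :: "nat list"
  assumes distinct_ms: "distinct ms"
    and root_unique: "unique_verts n chi (set ms) = {} \<or> r \<in> unique_verts n chi (set ms)"
begin

abbreviation "U \<equiv> unique_verts n chi (set ms)"

inductive_set T :: "nat set" where
  unique: "v \<in> U \<Longrightarrow> v \<in> T"
| up: "v \<in> T \<Longrightarrow> v \<noteq> r \<Longrightarrow> par v \<in> T"

text \<open>The root is included even if \<open>T\<close> is empty, so that the contracted vertex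
  always exists and can get number 0.\<close>

definition K :: "nat set" where "K = insert r T"

definition bad :: bool where
  "bad \<longleftrightarrow> \<not> set ms \<subseteq> chi ` {0..<n} \<or> \<not> chi ` T \<subseteq> set ms \<or> \<not> inj_on chi T"

definition kl :: "nat list" where "kl = r # filter (\<lambda>v. v \<notin> K) [0..<n]"

text \<open>The colour of \<open>r\<close> stays because \<open>r\<close> represents the contracted
  subtree; the other colours of \<open>T\<close> are met by the vertices that disappear.\<close>

definition cl :: "nat list" where "cl = filter (\<lambda>x. x \<notin> chi ` T \<or> x = chi r) ms"

text \<open>This is the contraction map onto the kernel; indexing into \<open>kl\<close> leads back
  to representatives, with \<open>r\<close> standing for all of \<open>K\<close>.\<close>

definition idx :: "nat \<Rightarrow> nat" where "idx v = (if v \<in> K then 0 else pos kl v)"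

text \<open>Colour 0 lies outside the reduced motif. Vertices with a dropped or foreign colour keep
  their place in the tree, but no solution can use them.\<close>

definition newcol :: "nat \<Rightarrow> nat" where
  "newcol x = (if x \<in> set cl then Suc (pos cl x) else 0)"

definition par' :: "nat \<Rightarrow> nat" where "par' u = idx (par (kl ! u))"

definition chi' :: "nat \<Rightarrow> nat" where "chi' u = newcol (chi (kl ! u))"

lemma T_less: "v \<in> T \<Longrightarrow> v < n"
  by (induction rule: T.induct) (use par_in in \<open>auto simp: unique_verts_def\<close>)

text \<open>Read from children to parent, this is the marking rule of the pruning loop.\<close>

lemma in_T_iff: "v \<in> T \<longleftrightarrow> v \<in> U \<or> (\<exists>c<n. c \<noteq> r \<and> par c = v \<and> c \<in> T)"
  by (subst T.simps) (use T_less in blast)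

lemma r_unique: "T \<noteq> {} \<Longrightarrow> r \<in> U"
proof -
  have "v \<in> T \<Longrightarrow> U \<noteq> {}" for v by (induction rule: T.induct) auto
  then show "T \<noteq> {} \<Longrightarrow> r \<in> U" using root_unique by blast
qed

lemma r_in_T: "T \<noteq> {} \<Longrightarrow> r \<in> T"
  using r_unique T.unique by blast

lemma distinct_kl: "distinct kl" by (simp add: kl_def K_def)

lemma set_kl: "set kl = insert r ({0..<n} - K)" by (auto simp: kl_def)

lemma kl_0: "kl ! 0 = r" by (simp add: kl_def)

lemma length_kl_pos: "0 < length kl" by (simp add: kl_def)

lemma kl_idx: "v < n \<Longrightarrow> v \<notin> K \<or> v = r \<Longrightarrow> kl ! idx v = v"
  by (auto simp: idx_def kl_0 set_kl intro!: nth_pos)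

lemma idx_K: "v \<in> K \<Longrightarrow> idx v = 0" by (simp add: idx_def)

lemma idx_less: "v < n \<Longrightarrow> idx v < length kl"
  using length_kl_pos by (auto simp: idx_def set_kl intro!: pos_less)

lemma kl_less: "u < length kl \<Longrightarrow> kl ! u < n"
  using nth_mem[of u kl] root by (auto simp: set_kl)

lemma kl_cases: "u < length kl \<Longrightarrow> kl ! u \<notin> K \<or> kl ! u = r"
  using nth_mem[of u kl] by (auto simp: set_kl)

lemma kl_eq_r: "u < length kl \<Longrightarrow> kl ! u = r \<Longrightarrow> u = 0"
  using distinct_kl length_kl_pos kl_0 by (metis pos_nth)

lemma idx_kl: "u < length kl \<Longrightarrow> idx (kl ! u) = u"
  using kl_cases[of u] kl_eq_r[of u] pos_nth[OF distinct_kl, of u] by (auto simp: idx_def K_def)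

lemma newcol_eq_iff: "x \<in> set cl \<Longrightarrow> newcol x = newcol y \<longleftrightarrow> x = y"
  by (auto simp: newcol_def) (metis nth_pos)

lemma distinct_cl: "distinct cl" by (simp add: cl_def distinct_ms)

lemma newcol_image: "newcol ` set cl = {1..length cl}"
proof
  show "newcol ` set cl \<subseteq> {1..length cl}" by (auto simp: newcol_def Suc_le_eq pos_less)
  show "{1..length cl} \<subseteq> newcol ` set cl"
  proof
    fix j assume j: "j \<in> {1..length cl}"
    then have "j - 1 < length cl" by auto
    then have "newcol (cl ! (j - 1)) = j" "cl ! (j - 1) \<in> set cl"
      using j by (auto simp: newcol_def pos_nth distinct_cl)
    then show "j \<in> newcol ` set cl" by (metis imageI)
  qed
qed

lemma newcol_in_iff: "newcol x \<in> {1..length cl} \<longleftrightarrow> x \<in> set cl"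
  by (auto simp: newcol_def Suc_le_eq pos_less)

text \<open>A parent inside \<open>K\<close> becomes 0; any other parent is its own representative,
  so the old rank still decreases. The shift by \<open>Suc\<close> puts the new root strictly below
  all other vertices.\<close>

sublocale contracted: rooted_tree "{0..<length kl}" 0 par' "\<lambda>u. if u = 0 then 0 else Suc (rk (kl ! u))"
proof
  fix u assume u: "u \<in> {0..<length kl}" "u \<noteq> 0"
  then have v: "kl ! u < n" "kl ! u \<noteq> r" using kl_less kl_eq_r by auto
  then have p: "par (kl ! u) < n" "rk (par (kl ! u)) < rk (kl ! u)" using par_in rk_par by auto
  then show "par' u \<in> {0..<length kl}" using idx_less by (simp add: par'_def)
  show "(if par' u = 0 then 0 else Suc (rk (kl ! par' u))) < (if u = 0 then 0 else Suc (rk (kl ! u)))"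
    using u p kl_idx[of "par (kl ! u)"] by (auto simp: par'_def idx_def)
qed (use length_kl_pos in auto)

section \<open>Solutions before and after contraction\<close>

text \<open>The only vertex of a motif colour cannot be avoided. If there is such a vertex,
  \<open>r\<close> is one; only the top of a solution can be \<open>r\<close>, and all other
  vertices bring their parents along.\<close>

lemma forced:
  assumes S: "S \<subseteq> {0..<n}" "inj_on chi S" "chi ` S = set ms"
    and t: "t \<in> S" "\<And>v. v \<in> S \<Longrightarrow> v \<noteq> t \<Longrightarrow> v \<noteq> r \<and> par v \<in> S"
  shows "T \<subseteq> S" and "T \<noteq> {} \<Longrightarrow> t = r"
proof -
  have U: "v \<in> S" if "v \<in> U" for v
  proof -
    have "chi v \<in> chi ` S" using that S by (simp add: unique_verts_def)
    then obtain u where u: "u \<in> S" "chi u = chi v" by auto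
    then have "u < n" using S(1) by auto
    then show ?thesis using that u by (auto simp: unique_verts_def)
  qed
  show *: "t = r" if "T \<noteq> {}" using U[OF r_unique[OF that]] t(2) by blast
  have "v \<in> S" if "v \<in> T" for v
    using that by (induction rule: T.induct) (use U * t in auto)
  then show "T \<subseteq> S" by blast
qed

lemma bad_no_solution:
  assumes bad shows "\<not> rooted_solution n r par chi (set ms) S"
proof
  assume "rooted_solution n r par chi (set ms) S"
  then obtain t where S: "S \<subseteq> {0..<n}" "inj_on chi S" "chi ` S = set ms"
    and t: "t \<in> S" "\<And>v. v \<in> S \<Longrightarrow> v \<noteq> t \<Longrightarrow> v \<noteq> r \<and> par v \<in> S"
    by (auto simp: rooted_solution_def)
  note T = forced(1)[OF S t]
  show False using assms S T inj_on_subset[OF S(2) T] unfolding bad_def by blast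
qed

text \<open>The solution is restricted to representatives. If it meets \<open>K\<close>, it contains
  \<open>r\<close>, so closure under parents is inherited; it loses only vertices of
  \<open>T\<close>, whose colours leave the motif with them.\<close>

lemma solution_contract:
  assumes "rooted_solution n r par chi (set ms) S"
  shows "rooted_solution (length kl) 0 par' chi' {1..length cl} {u. u < length kl \<and> kl ! u \<in> S}"
    (is "rooted_solution _ _ _ _ _ ?S")
proof -
  obtain t where S: "S \<subseteq> {0..<n}" "inj_on chi S" "chi ` S = set ms"
    and t: "t \<in> S" "\<And>v. v \<in> S \<Longrightarrow> v \<noteq> t \<Longrightarrow> v \<noteq> r \<and> par v \<in> S"
    using assms by (auto simp: rooted_solution_def)
  note T = forced[OF S t]
  have idxS: "idx v \<in> ?S" if v: "v \<in> S" for v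
  proof (cases "v \<in> K")
    case True
    then have "r \<in> S" using v T(1) r_in_T by (auto simp: K_def)
    then show ?thesis using True length_kl_pos by (simp add: idx_K kl_0)
  next
    case False
    then show ?thesis using v S(1) kl_idx[of v] idx_less[of v] by auto
  qed
  \<comment> \<open>A representative outside \<open>T\<close> cannot carry a colour of
    \<open>T\<close>, because \<open>T\<close> is part of \<open>S\<close> and the colours in
    \<open>S\<close> are distinct.\<close>
  have inCl: "chi (kl ! u) \<in> set cl" if u: "u \<in> ?S" for u
  proof -
    have "chi (kl ! u) \<in> set ms" using S u by blast
    moreover have "chi (kl ! u) = chi r" if c: "chi (kl ! u) \<in> chi ` T"
    proof -
      obtain v where v: "v \<in> T" "chi (kl ! u) = chi v"  using c by blast
      then have "kl ! u = v" using u T(1) inj_onD[OF S(2)] by blast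
      then have "kl ! u \<in> T" using v by simp
      then show ?thesis using kl_cases[of u] u by (auto simp: K_def)
    qed
    ultimately show ?thesis by (auto simp: cl_def)
  qed
  have "inj_on chi' ?S"
  proof (rule inj_onI)
    fix u v assume uv: "u \<in> ?S" "v \<in> ?S" "chi' u = chi' v"
    then have "chi (kl ! u) = chi (kl ! v)" using newcol_eq_iff[OF inCl] by (simp add: chi'_def)
    then have "kl ! u = kl ! v" using uv S(2) by (auto dest: inj_onD)
    then show "u = v" using idx_kl uv by (metis (no_types, lifting) mem_Collect_eq)
  qed
  moreover have "chi' ` ?S = {1..length cl}"
  proof
    show "chi' ` ?S \<subseteq> {1..length cl}"
    proof
      fix y assume "y \<in> chi' ` ?S"
      then obtain u where "u \<in> ?S" "y = chi' u" by blast
      then show "y \<in> {1..length cl}" using inCl[of u] newcol_in_iff unfolding chi'_def by blast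
    qed
    have "newcol x \<in> chi' ` ?S" if x: "x \<in> set cl" for x
    proof -
      have "x \<in> set ms" using x by (simp add: cl_def)
      then have "x \<in> chi ` S" using S(3) by simp
      then obtain v where v: "v \<in> S" "chi v = x" by blast
      \<comment> \<open>The only kept colour of \<open>T\<close> is that of \<open>r\<close>, so a
        vertex of \<open>T\<close> whose colour survives is \<open>r\<close> itself.\<close>
      have "kl ! idx v = v"
      proof (cases "v \<in> T")
        case True
        then have "chi v = chi r" using x v by (auto simp: cl_def)
        then have "v = r" using True r_in_T T(1) S(2) by (metis empty_iff inj_on_def subsetD)
        then show ?thesis using kl_idx root by auto
      next
        case False then show ?thesis using kl_idx[of v] v S(1) by (auto simp: K_def)
      qed
      then have "chi' (idx v) = newcol x" using v by (simp add: chi'_def)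
      then show ?thesis using idxS[OF v(1)] by (metis imageI)
    qed
    then show "{1..length cl} \<subseteq> chi' ` ?S" unfolding newcol_image[symmetric] by blast
  qed
  moreover have "u \<noteq> 0 \<and> par' u \<in> ?S" if u: "u \<in> ?S" "u \<noteq> idx t" for u
  proof -
    have "kl ! u \<noteq> t" using u idx_kl by auto
    then have *: "kl ! u \<noteq> r" "par (kl ! u) \<in> S" using t(2) u by auto
    moreover from *(1) have "u \<noteq> 0" using kl_0 by metis
    ultimately show ?thesis using idxS[OF *(2)] by (simp add: par'_def)
  qed
  moreover have "idx t \<in> ?S" using idxS t by blast
  ultimately show ?thesis unfolding rooted_solution_def by auto
qed

text \<open>Undoing the contraction puts back all of \<open>T\<close> once the solution contains 0.
  It does so if \<open>T\<close> is not empty, for then the kept colour of \<open>r\<close> occurs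
  nowhere else. The colours put back are those that were removed from the motif.\<close>

lemma solution_expand:
  assumes good: "\<not> bad" and sol: "rooted_solution (length kl) 0 par' chi' {1..length cl} S"
  shows "rooted_solution n r par chi (set ms) {v. v < n \<and> idx v \<in> S}"
    (is "rooted_solution _ _ _ _ _ ?S")
proof -
  have g: "chi ` T \<subseteq> set ms" "inj_on chi T" using good by (auto simp: bad_def)
  obtain t where S: "S \<subseteq> {0..<length kl}" "inj_on chi' S" "chi' ` S = {1..length cl}"
    and t: "t \<in> S" "\<And>v. v \<in> S \<Longrightarrow> v \<noteq> t \<Longrightarrow> v \<noteq> 0 \<and> par' v \<in> S"
    using sol by (auto simp: rooted_solution_def)
  have zero: "0 \<in> S \<and> t = 0" if "T \<noteq> {}"
  proof -
    have rU: "r \<in> U" using r_unique[OF that] .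
    then have r: "chi r \<in> set cl" by (auto simp: cl_def unique_verts_def)
    then have "newcol (chi r) \<in> chi' ` S" using newcol_in_iff S(3) by blast
    then obtain u where u: "u \<in> S" "newcol (chi r) = newcol (chi (kl ! u))" by (auto simp: chi'_def)
    then have c: "chi (kl ! u) = chi r" using newcol_eq_iff[OF r] by auto
    have "u < length kl" using u S by auto
    then have "u = 0" using c rU kl_less[of u] kl_eq_r[of u] by (auto simp: unique_verts_def)
    then show ?thesis using u t(2) by auto
  qed
  have TS: "T \<subseteq> ?S"
  proof
    fix v assume v: "v \<in> T"
    then show "v \<in> ?S" using zero T_less[OF v] idx_K[of v] by (auto simp: K_def)
  qed
  have inCl: "chi v \<in> set cl" if v: "v \<in> ?S" "v \<notin> T \<or> v = r" for v
  proof -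
    have "kl ! idx v = v" using kl_idx v by (auto simp: K_def)
    then have "newcol (chi v) = chi' (idx v)" by (simp add: chi'_def)
    then have "newcol (chi v) \<in> {1..length cl}" using v(1) S(3) by blast
    then show ?thesis using newcol_in_iff by blast
  qed
  have "inj_on chi ?S"
  proof (rule inj_onI)
    \<comment> \<open>The vertex \<open>v\<close> is a representative used by the solution, so its
      colour is kept. The only kept colour of \<open>T\<close> is that of \<open>r\<close>, and
      \<open>chi\<close> is injective on \<open>T\<close> because the instance is not
      \<open>bad\<close>.\<close>
    have mixed: "u = r" if "u \<in> T" "v \<in> ?S" "v \<notin> T \<or> v = r" "chi u = chi v" for u v
    proof -
      have "chi v \<in> chi ` T" using that(1,4) by (metis imageI)
      then have "chi u = chi r" using inCl[OF that(2,3)] that(4) by (simp add: cl_def)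
      then show ?thesis using that(1) r_in_T g(2) by (metis empty_iff inj_onD)
    qed
    fix u v assume uv: "u \<in> ?S" "v \<in> ?S" "chi u = chi v"
    consider "u \<in> T" "v \<in> T" | "u \<in> T" "v \<notin> T" | "u \<notin> T" "v \<in> T" | "u \<notin> T" "v \<notin> T" by blast
    then have "(u \<in> T \<and> v \<in> T) \<or> ((u \<notin> T \<or> u = r) \<and> (v \<notin> T \<or> v = r))"
      using mixed[of u v] mixed[of v u] uv by cases auto
    then show "u = v"
    proof
      assume "u \<in> T \<and> v \<in> T" then show ?thesis using g(2) uv by (auto dest: inj_onD)
    next
      assume *: "(u \<notin> T \<or> u = r) \<and> (v \<notin> T \<or> v = r)"
      then have k: "kl ! idx u = u" "kl ! idx v = v" using kl_idx uv by (auto simp: K_def)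
      then have "chi' (idx u) = chi' (idx v)" using uv by (simp add: chi'_def)
      then have "idx u = idx v" using uv S(2) by (auto dest: inj_onD)
      then show ?thesis using k by metis
    qed
  qed
  moreover have "chi ` ?S = set ms"
  proof
    show "chi ` ?S \<subseteq> set ms"
    proof
      fix x assume "x \<in> chi ` ?S"
      then obtain v where "v \<in> ?S" "x = chi v" by blast
      then show "x \<in> set ms" using inCl[of v] g(1) by (cases "v \<in> T") (auto simp: cl_def)
    qed
    show "set ms \<subseteq> chi ` ?S"
    proof
      fix x assume x: "x \<in> set ms"
      show "x \<in> chi ` ?S"
      proof (cases "x \<in> chi ` T")
        case True then show ?thesis using TS by blast
      next
        case False
        then have xc: "x \<in> set cl" using x by (simp add: cl_def)
        then have "newcol x \<in> chi' ` S" using newcol_in_iff S(3) by blast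
        then obtain u where u: "u \<in> S" "newcol x = newcol (chi (kl ! u))" by (auto simp: chi'_def)
        then have c: "chi (kl ! u) = x" using newcol_eq_iff[OF xc] by auto
        have "u < length kl" using u S by auto
        then have "kl ! u \<in> ?S" using u kl_less idx_kl by auto
        then show ?thesis using c by blast
      qed
    qed
  qed
  moreover have "kl ! t \<in> ?S" using t(1) S(1) kl_less[of t] idx_kl[of t] by auto
  moreover have "v \<noteq> r \<and> par v \<in> ?S" if v: "v \<in> ?S" "v \<noteq> kl ! t" for v
  proof (cases "v \<in> T")
    case True
    then have "T \<noteq> {}" by blast
    then have "v \<noteq> r" using zero v(2) kl_0 by auto
    then show ?thesis using T.up[OF True] TS by blast
  next
    case False
    then have k: "kl ! idx v = v" using kl_idx v by (auto simp: K_def)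
    then have "idx v \<noteq> t" using v by auto
    then have *: "idx v \<noteq> 0" "par' (idx v) \<in> S" using t(2) v by auto
    then have "v \<noteq> r" by (auto simp: idx_def K_def)
    then show ?thesis using * k v par_in[of v] by (auto simp: par'_def)
  qed
  ultimately show ?thesis unfolding rooted_solution_def by (intro conjI bexI[of _ "kl ! t"]) auto
qed

section \<open>Size of the reduced instance\<close>

text \<open>A valid instance has no more motif colours than vertices. Each kept colour occurs in the
  tree, and if it belongs to \<open>T\<close> it is the colour of \<open>r\<close>; so it occurs at
  a kernel vertex as well.\<close>

lemma length_cl_le:
  assumes "\<not> bad" shows "length cl \<le> length kl"
proof -
  have "{1..length cl} \<subseteq> chi' ` {0..<length kl}"
  proof -
    have "newcol x \<in> chi' ` {0..<length kl}" if x: "x \<in> set cl" for x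
    proof -
      have "x \<in> chi ` {0..<n}" using assms x by (auto simp: bad_def cl_def)
      then obtain v where v: "v < n" "chi v = x" by auto
      have "\<exists>v<n. chi v = x \<and> kl ! idx v = v"
      proof (cases "v \<in> T")
        case True
        then have "chi r = x" using x v by (auto simp: cl_def)
        then show ?thesis using kl_idx[of r] root by (intro exI[of _ r]) auto
      next
        case False
        then show ?thesis using kl_idx[of v] v by (intro exI[of _ v]) (auto simp: K_def)
      qed
      then obtain v where "v < n" "chi' (idx v) = newcol x" by (auto simp: chi'_def)
      then show ?thesis using idx_less[of v] by (metis atLeastLessThan_iff imageI le0)
    qed
    then show ?thesis unfolding newcol_image[symmetric] by blast
  qed
  then have "card {1..length cl} \<le> card (chi' ` {0..<length kl})" by (intro card_mono) auto
  also have "\<dots> \<le> length kl" using card_image_le[of "{0..<length kl}" chi'] by simp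
  finally show ?thesis by simp
qed

text \<open>Motif colours that are not unique occur at least twice.\<close>

lemma length_kl_le:
  assumes "\<not> bad" shows "length kl + 2 * length ms \<le> 2 * n + 1"
proof -
  have sub: "set ms \<subseteq> chi ` {0..<n}" using assms by (simp add: bad_def)
  \<comment> \<open>One vertex \<open>rep x\<close> is chosen per motif colour \<open>x\<close>. A
    unique vertex is the only candidate for its colour, so \<open>U\<close> lies in the set
    \<open>?R\<close> of chosen vertices.\<close>
  define rep where "rep x = (LEAST v. v < n \<and> chi v = x)" for x
  have rep: "rep x < n \<and> chi (rep x) = x" if "x \<in> set ms" for x
  proof -
    have "\<exists>v. v < n \<and> chi v = x" using sub that by fastforce
    then show ?thesis unfolding rep_def by (rule LeastI_ex)
  qed
  let ?R = "rep ` set ms"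
  have injr: "inj_on rep (set ms)" using rep by (metis inj_onI)
  have cR: "card ?R = length ms" using card_image[OF injr] distinct_card[OF distinct_ms] by simp
  have UR: "U \<subseteq> ?R"
  proof
    fix v assume "v \<in> U"
    then have "v = rep (chi v)" "chi v \<in> set ms" using rep[of "chi v"] by (auto simp: unique_verts_def)
    then show "v \<in> ?R" by blast
  qed
  \<comment> \<open>A chosen vertex that is not unique has a twin of its colour that was not chosen.
    Comparing the colours of both sides gives \<open>card (?R - U) <= n - length ms\<close>.\<close>
  have "\<exists>u<n. u \<notin> ?R \<and> chi u = chi v" if v: "v \<in> ?R - U" for v
  proof -
    obtain x where x: "x \<in> set ms" "v = rep x" using v by blast
    then have "chi v = x" "v < n" using rep by auto
    then obtain u where u: "u < n" "chi u = x" "u \<noteq> v" using v x by (auto simp: unique_verts_def)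
    have "u \<notin> ?R" using rep u x by auto
    then show ?thesis using u \<open>chi v = x\<close> by (intro exI[of _ u]) simp
  qed
  then have "chi ` (?R - U) \<subseteq> chi ` ({0..<n} - ?R)"
    by (metis (no_types, lifting) DiffI atLeastLessThan_iff image_eqI image_subsetI le0)
  then have "card (chi ` (?R - U)) \<le> card (chi ` ({0..<n} - ?R))" by (intro card_mono) auto
  also have "\<dots> \<le> card ({0..<n} - ?R)" by (intro card_image_le) auto
  finally have "card (chi ` (?R - U)) \<le> card ({0..<n} - ?R)" .
  moreover have "inj_on chi (?R - U)"
  proof (rule inj_onI)
    fix u v assume uv: "u \<in> ?R - U" "v \<in> ?R - U" "chi u = chi v"
    then obtain x y where xy: "x \<in> set ms" "u = rep x" "y \<in> set ms" "v = rep y" by blast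
    then have "x = y" using uv(3) rep[of x] rep[of y] by simp
    then show "u = v" using xy by simp
  qed
  then have "card (chi ` (?R - U)) = card (?R - U)" by (rule card_image)
  ultimately have "card (?R - U) \<le> card ({0..<n} - ?R)" by simp
  moreover have "card ({0..<n} - ?R) = n - length ms" "length ms \<le> n"
  proof -
    have "?R \<subseteq> {0..<n}" using rep by auto
    then show "card ({0..<n} - ?R) = n - length ms" "length ms \<le> n"
      using cR card_Diff_subset[of ?R "{0..<n}"] card_mono[of "{0..<n}" ?R] by auto
  qed
  moreover have "finite U" by (rule finite_subset[of _ "{0..<n}"]) (auto simp: unique_verts_def)
  then have "card (?R - U) = length ms - card U" "card U \<le> length ms"
    using cR UR card_Diff_subset[of U ?R] card_mono[of ?R U] by auto
  \<comment> \<open>Contraction deletes every unique vertex except possibly \<open>r\<close>, the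
    source of the \<open>+ 1\<close>.\<close>
  moreover have "length kl + card U \<le> n + 1"
  proof -
    have "set kl \<subseteq> insert r ({0..<n} - U)" using T.unique by (auto simp: set_kl K_def)
    then have "card (set kl) \<le> card (insert r ({0..<n} - U))" by (intro card_mono) auto
    also have "\<dots> \<le> Suc (card ({0..<n} - U))" by (simp add: card_insert_if)
    finally have "length kl \<le> Suc (card ({0..<n} - U))" using distinct_card[OF distinct_kl] by simp
    moreover have "U \<subseteq> {0..<n}" by (auto simp: unique_verts_def)
    then have "card ({0..<n} - U) = n - card U" "card U \<le> n"
      using \<open>finite U\<close> card_Diff_subset[of U "{0..<n}"] card_mono[of "{0..<n}" U] by auto
    ultimately show ?thesis by simp
  qed
  ultimately show ?thesis by linarith
qed

end

subsection \<open>The kernelization program\<close>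

abbreviation Seq_infix :: "com \<Rightarrow> com \<Rightarrow> com" (infixr \<open>;;\<close> 60) where
  "c1 ;; c2 \<equiv> Seq c1 c2"

abbreviation color :: "aexp \<Rightarrow> aexp" where
  "color e \<equiv> Elem ''in'' (Plus (V ''cb'') e)"

text \<open>The registers \<open>''cb''\<close>, \<open>''fb''\<close> and \<open>''sb''\<close>
  hold the offsets of the colour block and of the blocks of first and second end points.\<close>

definition read_prog :: com where
  "read_prog =
     Assign ''n'' (Elem ''in'' (N 0)) ;; Assign ''m'' (Elem ''in'' (N 2)) ;;
     Assign ''e'' (Elem ''in'' (N 3)) ;; Assign ''cb'' (Plus (N 4) (V ''m'')) ;;
     Assign ''fb'' (Plus (V ''cb'') (V ''n'')) ;; Assign ''sb'' (Plus (V ''fb'') (V ''e''))"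

definition motif_prog :: com where
  "motif_prog = For ''i'' ''m'' (Update ''M'' (Elem ''in'' (Plus (N 4) (V ''i''))) (N 1))"

definition count_prog :: com where
  "count_prog = For ''i'' ''n''
     (Update ''cnt'' (color (V ''i'')) (Plus (Elem ''cnt'' (color (V ''i''))) (N 1)))"

definition degree_prog :: com where
  "degree_prog = For ''i'' ''e''
     (Assign ''u'' (Elem ''in'' (Plus (V ''fb'') (V ''i''))) ;;
      Assign ''v'' (Elem ''in'' (Plus (V ''sb'') (V ''i''))) ;;
      Update ''deg'' (V ''u'') (Plus (Elem ''deg'' (V ''u'')) (N 1)) ;;
      Update ''deg'' (V ''v'') (Plus (Elem ''deg'' (V ''v'')) (N 1)) ;;
      Update ''sum'' (V ''u'') (Plus (Elem ''sum'' (V ''u'')) (V ''v'')) ;;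
      Update ''sum'' (V ''v'') (Plus (Elem ''sum'' (V ''v'')) (V ''u'')))"

definition unique_prog :: com where
  "unique_prog = Assign ''r'' (N 0) ;; For ''i'' ''n''
     (If (Conj (Equal (Elem ''M'' (color (V ''i''))) (N 1)) (Equal (Elem ''cnt'' (color (V ''i''))) (N 1)))
       (Update ''mark'' (V ''i'') (N 1) ;; Assign ''r'' (V ''i'')) Skip)"

text \<open>A leaf \<open>v\<close> other than the root has its parent as only remaining neighbour, so that \<open>sum[v]\<close> is
  the parent. Removing \<open>v\<close> can turn only the parent into a leaf, which is therefore inspected next.\<close>

definition prune_prog :: com where
  "prune_prog = Assign ''i'' (N 0) ;; Assign ''v'' (N 0) ;;
     While (Less (V ''i'') (V ''n''))
      (If (Conj (Neg (Equal (V ''v'') (V ''r''))) (Equal (Elem ''deg'' (V ''v'')) (N 1)))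
        (Assign ''p'' (Elem ''sum'' (V ''v'')) ;;
         Update ''par'' (V ''v'') (V ''p'') ;;
         Update ''deg'' (V ''v'') (N 0) ;;
         Update ''deg'' (V ''p'') (Minus (Elem ''deg'' (V ''p'')) (N 1)) ;;
         Update ''sum'' (V ''p'') (Minus (Elem ''sum'' (V ''p'')) (V ''v'')) ;;
         If (Equal (Elem ''mark'' (V ''v'')) (N 1)) (Update ''mark'' (V ''p'') (N 1)) Skip ;;
         Assign ''v'' (V ''p''))
        (Assign ''i'' (Plus (V ''i'') (N 1)) ;; Assign ''v'' (V ''i'')))"

definition absent_prog :: com where
  "absent_prog = Assign ''bad'' (N 0) ;; For ''i'' ''m''
     (If (Equal (Elem ''cnt'' (Elem ''in'' (Plus (N 4) (V ''i'')))) (N 0)) (Assign ''bad'' (N 1)) Skip)"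

definition forced_prog :: com where
  "forced_prog = For ''i'' ''n''
     (If (Equal (Elem ''mark'' (V ''i'')) (N 1))
       (If (Equal (Elem ''M'' (color (V ''i''))) (N 1)) Skip (Assign ''bad'' (N 1)) ;;
        If (Equal (Elem ''seen'' (color (V ''i''))) (N 1)) (Assign ''bad'' (N 1)) Skip ;;
        Update ''seen'' (color (V ''i'')) (N 1))
       Skip)"

text \<open>The word encodes one vertex, one colour and an empty motif. This is a no-instance, since
  a connected set is nonempty and has at least one colour to match.\<close>

definition reject_prog :: com where
  "reject_prog =
     Update ''out'' (N 0) (N 1) ;; Update ''out'' (N 1) (N 1) ;; Update ''out'' (N 2) (N 0) ;;
     Update ''out'' (N 3) (N 0) ;; Update ''out'' (N 4) (N 0) ;; Assign ''out_len'' (N 5)"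

text \<open>Colours that receive no number keep the initial 0, the colour outside the reduced
  motif.\<close>

definition recolor_prog :: com where
  "recolor_prog = Assign ''q'' (N 0) ;; For ''i'' ''m''
     (Assign ''x'' (Elem ''in'' (Plus (N 4) (V ''i''))) ;;
      If (Conj (Equal (Elem ''seen'' (V ''x'')) (N 1)) (Neg (Equal (V ''x'') (color (V ''r'')))))
        Skip
        (Assign ''q'' (Plus (V ''q'') (N 1)) ;; Update ''ncol'' (V ''x'') (V ''q'')))"

text \<open>Vertices of \<open>K\<close> are passed over and keep the initial index 0, that of the
  contracted vertex.\<close>

definition renumber_prog :: com where
  "renumber_prog = Assign ''k'' (N 1) ;; Update ''kl'' (N 0) (V ''r'') ;; For ''i'' ''n''
     (If (Conj (Neg (Equal (V ''i'') (V ''r''))) (Neg (Equal (Elem ''mark'' (V ''i'')) (N 1))))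
       (Update ''kl'' (V ''k'') (V ''i'') ;; Update ''idx'' (V ''i'') (V ''k'') ;;
        Assign ''k'' (Plus (V ''k'') (N 1)))
       Skip)"

definition out_head_prog :: com where
  "out_head_prog =
     Assign ''l'' (Minus (V ''k'') (N 1)) ;; Assign ''ob'' (Plus (N 4) (V ''q'')) ;;
     Assign ''pb'' (Plus (V ''ob'') (V ''k'')) ;; Assign ''pc'' (Plus (V ''pb'') (V ''l'')) ;;
     Assign ''out_len'' (Plus (V ''pc'') (V ''l'')) ;;
     Update ''out'' (N 0) (V ''k'') ;; Update ''out'' (N 1) (Plus (V ''q'') (N 1)) ;;
     Update ''out'' (N 2) (V ''q'') ;; Update ''out'' (N 3) (V ''l'')"

definition out_motif_prog :: com where
  "out_motif_prog = For ''i'' ''q'' (Update ''out'' (Plus (N 4) (V ''i'')) (Plus (V ''i'') (N 1)))"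

definition out_color_prog :: com where
  "out_color_prog = For ''i'' ''k''
     (Update ''out'' (Plus (V ''ob'') (V ''i'')) (Elem ''ncol'' (color (Elem ''kl'' (V ''i'')))))"

definition out_edge_prog :: com where
  "out_edge_prog = For ''i'' ''l''
     (Update ''out'' (Plus (V ''pb'') (V ''i'')) (Plus (V ''i'') (N 1)) ;;
      Update ''out'' (Plus (V ''pc'') (V ''i''))
        (Elem ''idx'' (Elem ''par'' (Elem ''kl'' (Plus (V ''i'') (N 1))))))"

definition kernel_prog :: com where
  "kernel_prog = read_prog ;; motif_prog ;; count_prog ;; degree_prog ;; unique_prog ;; prune_prog ;;
     absent_prog ;; forced_prog ;;
     If (Equal (V ''bad'') (N 1)) reject_prog
      (recolor_prog ;; renumber_prog ;; out_head_prog ;; out_motif_prog ;; out_color_prog ;; out_edge_prog)"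

section \<open>Correctness of reading, counting and marking\<close>

text \<open>The assumption \<open>r_eq\<close> describes the root that an ascending scan leaves
  behind: the last unique vertex, or the initial value 0.\<close>

locale kernel_run = rooted_motif n r par rk chi ms
  for n r par rk chi ms +
  fixes es :: "(nat \<times> nat) list" and nc :: nat
  assumes distinct_es: "distinct es"
    and es_disjoint: "set es \<inter> (set es)\<inverse> = {}"
    and arcs_es: "up \<union> up\<inverse> = set es \<union> (set es)\<inverse>"
    and length_ms: "length ms \<le> n"
    and r_eq: "r = (if unique_verts n chi (set ms) = {} then 0 else Max (unique_verts n chi (set ms)))"
begin

definition input :: "nat list" where
  "input = [n, nc, length ms, length es] @ ms @ map chi [0..<n] @ map fst es @ map snd es"

definition input_ok :: "state \<Rightarrow> bool" where
  "input_ok s \<longleftrightarrow>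
     (\<forall>i<length ms. arr s ''in'' (4 + i) = ms ! i) \<and>
     (\<forall>i<n. arr s ''in'' (4 + length ms + i) = chi i) \<and>
     (\<forall>i<length es. arr s ''in'' (4 + length ms + n + i) = fst (es ! i)) \<and>
     (\<forall>i<length es. arr s ''in'' (4 + length ms + n + length es + i) = snd (es ! i)) \<and>
     reg s ''n'' = n \<and> reg s ''m'' = length ms \<and> reg s ''e'' = length es \<and>
     reg s ''cb'' = 4 + length ms \<and> reg s ''fb'' = 4 + length ms + n \<and>
     reg s ''sb'' = 4 + length ms + n + length es"

lemma input_ok_frame:
  assumes "frame c s s'" "input_ok s" "''in'' \<notin> amod c"
    "''n'' \<notin> rmod c" "''m'' \<notin> rmod c" "''e'' \<notin> rmod c" "''cb'' \<notin> rmod c" "''fb'' \<notin> rmod c" "''sb'' \<notin> rmod c"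
  shows "input_ok s'"
  using assms by (simp add: input_ok_def frame_def)

text \<open>Every edge joins a vertex to its parent, so the loop over the edges has at most
  \<open>n\<close> rounds. The list accounts for exactly \<open>2 * length es\<close> arcs because
  no arc is listed together with its reverse.\<close>

lemma length_es: "length es \<le> n"
proof -
  have "card up \<le> n"
  proof -
    have "up = (\<lambda>v. (v, par v)) ` ({0..<n} - {r})" by (auto simp: up_def)
    then have "card up \<le> card ({0..<n} - {r})" by (metis card_image_le finite_Diff finite_atLeastLessThan)
    also have "\<dots> \<le> card {0..<n}" by (intro card_mono) auto
    finally show ?thesis by simp
  qed
  moreover have "card (set es \<union> (set es)\<inverse>) = card (set es) + card ((set es)\<inverse>)"
    using es_disjoint by (intro card_Un_disjoint) auto
  then have "2 * length es = card (set es \<union> (set es)\<inverse>)"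
    by (simp add: distinct_card[OF distinct_es])
  moreover have "card (up \<union> up\<inverse>) \<le> 2 * card up"
    using card_Un_le[of up "up\<inverse>"] by simp
  ultimately show ?thesis unfolding arcs_es by linarith
qed

lemma ok_read:
  "ok b read_prog (init_state input) (\<lambda>s'. input_ok s')"
  by (rule ok_run) (auto simp: read_prog_def init_state_def input_ok_def input_def nth_append nth_Cons')

text \<open>The common bound \<open>2 * n\<close> is that of the pruning loop. Every other loop
  makes at most \<open>n\<close> rounds and is granted the same bound, so that the phases
  compose.\<close>

lemma ok_motif:
  assumes "input_ok s" "arr s ''M'' = (\<lambda>_. 0)"
  shows "ok (2 * n) motif_prog s (\<lambda>s'. arr s' ''M'' = (\<lambda>x. if x \<in> set ms then 1 else 0))"
  unfolding motif_prog_def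
proof (rule ok_For[where I = "\<lambda>i s'. arr s' ''M'' = (\<lambda>x. if x \<in> set (take i ms) then 1 else 0)"])
  fix i s' assume fr: "frame (For ''i'' ''m'' (Update ''M'' (Elem ''in'' (Plus (N 4) (V ''i''))) (N 1))) s s'"
    and i: "i < reg s ''m''" "reg s' ''i'' = i"
    and I: "arr s' ''M'' = (\<lambda>x. if x \<in> set (take i ms) then 1 else 0)"
  have "input_ok s'" by (rule input_ok_frame[OF fr assms(1)]) simp_all
  then show "arr (run (Update ''M'' (Elem ''in'' (Plus (N 4) (V ''i''))) (N 1)) s') ''M'' =
    (\<lambda>x. if x \<in> set (take (Suc i) ms) then 1 else 0)"
    using assms(1) i I by (auto simp: input_ok_def take_Suc_conv_app_nth)
qed (use assms length_ms in \<open>auto simp: input_ok_def\<close>)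

lemma ok_count:
  assumes "input_ok s" "arr s ''cnt'' = (\<lambda>_. 0)"
  shows "ok (2 * n) count_prog s (\<lambda>s'. arr s' ''cnt'' = (\<lambda>x. card {v. v < n \<and> chi v = x}))"
  unfolding count_prog_def
proof (rule ok_For[where I = "\<lambda>i s'. arr s' ''cnt'' = (\<lambda>x. card {v. v < i \<and> chi v = x})"], goal_cases)
  case (8 i s')
  have "input_ok s'" by (rule input_ok_frame[OF 8(1) assms(1)]) simp_all
  moreover have "card {v. v < Suc i \<and> chi v = x} = card {v. v < i \<and> chi v = x} + (if chi i = x then 1 else 0)" for x
  proof -
    have "{v. v < Suc i \<and> chi v = x} = {v. v < i \<and> chi v = x} \<union> (if chi i = x then {i} else {})"
      by (auto simp: less_Suc_eq)
    then show ?thesis by simp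
  qed
  ultimately show ?case using assms(1) 8 by (auto simp: input_ok_def)
qed (use assms in \<open>auto simp: input_ok_def\<close>)

definition nb :: "nat \<Rightarrow> nat set" where
  "nb v = {u. (v, u) \<in> set es \<union> (set es)\<inverse>}"

lemma ok_degree:
  assumes "input_ok s" "arr s ''deg'' = (\<lambda>_. 0)" "arr s ''sum'' = (\<lambda>_. 0)"
  shows "ok (2 * n) degree_prog s (\<lambda>s'. arr s' ''deg'' = (\<lambda>v. card (nb v)) \<and> arr s' ''sum'' = (\<lambda>v. \<Sum>(nb v)))"
  unfolding degree_prog_def
proof (rule ok_For[where I = "\<lambda>i s'.
    arr s' ''deg'' = (\<lambda>v. card {u. (v, u) \<in> set (take i es) \<union> (set (take i es))\<inverse>}) \<and>
    arr s' ''sum'' = (\<lambda>v. \<Sum>{u. (v, u) \<in> set (take i es) \<union> (set (take i es))\<inverse>})"], goal_cases)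
  case (8 i s')
  let ?nb = "\<lambda>i v. {u. (v, u) \<in> set (take i es) \<union> (set (take i es))\<inverse>}"
  have ok: "input_ok s'" by (rule input_ok_frame[OF 8(1) assms(1)]) simp_all
  have i: "i < length es" using 8(2) assms(1) by (simp add: input_ok_def)
  obtain a b where ab: "es ! i = (a, b)" by (cases "es ! i")
  have mem: "(a, b) \<in> set es" using i ab nth_mem by metis
  have ne: "a \<noteq> b" using mem es_disjoint by blast
  have tk: "set (take (Suc i) es) = insert (a, b) (set (take i es))"
    using i ab by (simp add: take_Suc_conv_app_nth)
  \<comment> \<open>Neither orientation of the edge was listed before, so each end point is a new
    neighbour of the other, and degrees and sums count every neighbour once.\<close>
  have "(a, b) \<notin> set (take i es)"
    using distinct_es i ab by (metis distinct_take id_take_nth_drop not_distinct_conv_prefix take_Suc_conv_app_nth)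
  moreover have "(b, a) \<notin> set (take i es)"
    using mem es_disjoint in_set_takeD by fastforce
  ultimately have new: "b \<notin> ?nb i a" "a \<notin> ?nb i b" by auto
  have fin: "finite (?nb i v)" for v
    by (rule finite_subset[of _ "fst ` set es \<union> snd ` set es"]) (force dest: in_set_takeD)+
  have nb: "?nb (Suc i) v = (if v = a then insert b (?nb i a) else if v = b then insert a (?nb i b) else ?nb i v)" for v
    using ne by (auto simp: tk)
  have u: "arr s' ''in'' (reg s' ''fb'' + reg s' ''i'') = a" "arr s' ''in'' (reg s' ''sb'' + reg s' ''i'') = b"
    using ok 8(3) i ab by (auto simp: input_ok_def)
  have d: "card (?nb (Suc i) v) = (if v = a then card (?nb i a) + 1 else if v = b then card (?nb i b) + 1 else card (?nb i v))"
    and s: "\<Sum>(?nb (Suc i) v) = (if v = a then \<Sum>(?nb i a) + b else if v = b then \<Sum>(?nb i b) + a else \<Sum>(?nb i v))" for v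
    unfolding nb using new fin by simp_all
  show ?case unfolding d s using 8(4) u ne by (auto simp: fun_eq_iff)
qed (use assms length_es in \<open>auto simp: input_ok_def nb_def\<close>)

lemma ok_unique:
  assumes "input_ok s" "arr s ''mark'' = (\<lambda>_. 0)" "arr s ''M'' = (\<lambda>x. if x \<in> set ms then 1 else 0)"
    "arr s ''cnt'' = (\<lambda>x. card {v. v < n \<and> chi v = x})"
  shows "ok (2 * n) unique_prog s (\<lambda>s'. arr s' ''mark'' = (\<lambda>v. if v \<in> U then 1 else 0) \<and> reg s' ''r'' = r)"
  unfolding unique_prog_def
proof (rule ok_Seq[where ?Q1.0 = "\<lambda>s'. reg s' ''r'' = 0"], goal_cases)
  case (2 s1)
  let ?U = "\<lambda>i. {v \<in> U. v < i}"
  have s1: "input_ok s1" by (rule input_ok_frame[OF 2(1) assms(1)]) simp_all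
  have Un: "?U n = U" by (auto simp: unique_verts_def)
  note fr1 = frame_arr[OF 2(1)]
  show ?case
  proof (rule ok_For[where I = "\<lambda>i s'. arr s' ''mark'' = (\<lambda>v. if v \<in> ?U i then 1 else 0) \<and>
      reg s' ''r'' = (if ?U i = {} then 0 else Max (?U i))"], goal_cases)
    case (8 i s')
    have ok: "input_ok s'" by (rule input_ok_frame[OF 8(1) s1]) simp_all
    have i: "i < n" using 8(2) s1 by (simp add: input_ok_def)
    have c: "arr s' ''in'' (reg s' ''cb'' + reg s' ''i'') = chi i" using ok 8(3) i by (auto simp: input_ok_def)
    have "card {v. v < n \<and> chi v = chi i} = 1 \<longleftrightarrow> (\<forall>u<n. chi u = chi i \<longrightarrow> u = i)"
    proof
      assume "card {v. v < n \<and> chi v = chi i} = 1"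
      then obtain x where x: "{v. v < n \<and> chi v = chi i} = {x}" by (auto simp: card_1_singleton_iff)
      have "u = x" if "u < n" "chi u = chi i" for u
      proof -
        have "u \<in> {v. v < n \<and> chi v = chi i}" using that by simp
        then show ?thesis unfolding x by simp
      qed
      then show "\<forall>u<n. chi u = chi i \<longrightarrow> u = i" using i by metis
    next
      assume "\<forall>u<n. chi u = chi i \<longrightarrow> u = i"
      then have "{v. v < n \<and> chi v = chi i} = {i}" using i by auto
      then show "card {v. v < n \<and> chi v = chi i} = 1" by simp
    qed
    then have iU: "i \<in> U \<longleftrightarrow> chi i \<in> set ms \<and> card {v. v < n \<and> chi v = chi i} = 1"
      using i by (simp add: unique_verts_def)
    have US: "?U (Suc i) = (if i \<in> U then insert i (?U i) else ?U i)" by (auto simp: less_Suc_eq)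
    \<comment> \<open>The scan is ascending, so a new unique vertex is the maximum so far.\<close>
    have M: "Max (insert i (?U i)) = i" by (intro Max_eqI) auto
    have "arr s' ''M'' (chi i) = 1 \<and> arr s' ''cnt'' (chi i) = 1 \<longleftrightarrow> i \<in> U"
      using frame_arr[OF 8(1), of "''M''"] frame_arr[OF 8(1), of "''cnt''"] fr1 assms iU by simp
    then show ?case using 8(3,4) c M by (auto simp: US fun_eq_iff)
  next
    case (9 s')
    have "reg s1 ''n'' = n" using s1 by (simp add: input_ok_def)
    from 9(2)[unfolded this Un] show ?case using r_eq by argo
  qed (use s1 2 fr1 assms in \<open>auto simp: input_ok_def\<close>)
qed (auto intro: ok_run)

section \<open>Removal of leaves\<close>

lemma in_nb_iff: "u \<in> nb v \<longleftrightarrow> (v < n \<and> v \<noteq> r \<and> u = par v) \<or> (u < n \<and> u \<noteq> r \<and> v = par u)"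
  unfolding nb_def arcs_es[symmetric] by (auto simp: in_up_iff)

lemma nb_less: "u \<in> nb v \<Longrightarrow> u < n"
  using par_in by (auto simp: in_nb_iff)

lemma finite_nb: "finite (nb v)"
  by (rule finite_subset[of _ "{0..<n}"]) (auto dest: nb_less)

lemma par_less: "v < n \<Longrightarrow> v \<noteq> r \<Longrightarrow> par v < n"
  using par_in by auto

lemma par_neq: "v < n \<Longrightarrow> v \<noteq> r \<Longrightarrow> par v \<noteq> v"
  using rk_par[of v] by auto

text \<open>Removed sets are closed under children, so the remaining vertices always form a subtree
  that contains the root.\<close>

definition pruned :: "nat set \<Rightarrow> bool" where
  "pruned X \<longleftrightarrow> X \<subseteq> {0..<n} - {r} \<and> (\<forall>c<n. c \<noteq> r \<longrightarrow> par c \<in> X \<longrightarrow> c \<in> X)"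

text \<open>A remaining vertex still has its parent, since removing the parent would have required
  removing the vertex first. The single remaining neighbour is therefore the parent, and all
  children are gone.\<close>

lemma pruned_leaf:
  assumes X: "pruned X" and v: "v < n" "v \<noteq> r" "v \<notin> X" and leaf: "card (nb v - X) = 1"
  shows "nb v - X = {par v}" and "\<And>c. c < n \<Longrightarrow> c \<noteq> r \<Longrightarrow> par c = v \<Longrightarrow> c \<in> X"
    and "pruned (insert v X)"
proof -
  have "par v \<in> nb v - X" using X v by (auto simp: pruned_def in_nb_iff)
  moreover obtain x where "nb v - X = {x}" using leaf by (auto simp: card_1_singleton_iff)
  ultimately show *: "nb v - X = {par v}" by auto
  show **: "c \<in> X" if "c < n" "c \<noteq> r" "par c = v" for c
  proof (rule ccontr)
    assume "c \<notin> X"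
    then have "c \<in> nb v - X" using that by (auto simp: in_nb_iff)
    then have "c = par v" using * by simp
    then show False using rk_par[of c] rk_par[of v] that v by simp
  qed
  show "pruned (insert v X)" using X v ** by (auto simp: pruned_def)
qed

text \<open>A remaining vertex of maximal rank other than the root has no remaining child, hence is
  a leaf. The removal cannot get stuck before only the root is left.\<close>

lemma pruned_all:
  assumes X: "pruned X" and no_leaf: "\<And>v. v < n \<Longrightarrow> v \<noteq> r \<Longrightarrow> v \<notin> X \<Longrightarrow> card (nb v - X) \<noteq> 1"
  shows "X = {0..<n} - {r}"
proof (rule ccontr)
  assume "X \<noteq> {0..<n} - {r}"
  then have "\<not> {0..<n} - {r} \<subseteq> X" using X by (auto simp: pruned_def)
  then obtain v0 where v0: "v0 < n \<and> v0 \<noteq> r \<and> v0 \<notin> X" by fastforce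
  let ?A = "{v. v < n \<and> v \<noteq> r \<and> v \<notin> X}"
  have A: "finite (rk ` ?A)" "rk ` ?A \<noteq> {}" using v0 by auto
  obtain v where v: "v \<in> ?A" "rk v = Max (rk ` ?A)" using Max_in[OF A] by auto
  have max: "rk u \<le> rk v" if "u \<in> ?A" for u using Max_ge[OF A(1)] that v(2) by simp
  have "nb v - X = {par v}"
  proof (intro equalityI subsetI)
    fix u assume u: "u \<in> nb v - X"
    show "u \<in> {par v}"
    proof (rule ccontr)
      assume "u \<notin> {par v}"
      then have c: "u < n" "u \<noteq> r" "v = par u" using u by (auto simp: in_nb_iff)
      then have "rk u \<le> rk v" using max u by simp
      then show False using rk_par[of u] c by simp
    qed
  next
    fix u assume "u \<in> {par v}"
    then show "u \<in> nb v - X" using v(1) X by (auto simp: in_nb_iff pruned_def)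
  qed
  then show False using no_leaf[of v] v(1) by simp
qed

text \<open>Marks include what removed children have passed on. By the last conjunct, only the
  current vertex can be a removable leaf among the scanned indices; with \<open>''v''\<close> equal
  to \<open>n\<close> at the end, no leaf is left.\<close>

definition prune_inv :: "nat set \<Rightarrow> state \<Rightarrow> bool" where
  "prune_inv X s \<longleftrightarrow> pruned X \<and>
     (\<forall>u<n. arr s ''deg'' u = (if u \<in> X then 0 else card (nb u - X))) \<and>
     (\<forall>u<n. u \<notin> X \<longrightarrow> arr s ''sum'' u = \<Sum>(nb u - X)) \<and>
     (\<forall>u\<in>X. arr s ''par'' u = par u) \<and>
     arr s ''mark'' = (\<lambda>u. if u \<in> U \<or> (\<exists>c\<in>X. par c = u \<and> c \<in> T) then 1 else 0) \<and>
     reg s ''i'' \<le> n \<and> (if reg s ''i'' < n then reg s ''v'' < n else reg s ''v'' = n) \<and>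
     (\<forall>j\<le>reg s ''i''. j < n \<longrightarrow> j \<noteq> reg s ''v'' \<longrightarrow> j = r \<or> arr s ''deg'' j \<noteq> 1)"

text \<open>Each round removes a vertex or advances the scan, so
  \<open>(n - i) + (n - card X)\<close> decreases, starting from \<open>2 * n\<close>. Climbing to a
  parent does not reset the scan, which keeps the time linear.\<close>

lemma ok_prune:
  assumes "input_ok s" "arr s ''deg'' = (\<lambda>v. card (nb v))" "arr s ''sum'' = (\<lambda>v. \<Sum>(nb v))"
    "arr s ''mark'' = (\<lambda>v. if v \<in> U then 1 else 0)" "reg s ''r'' = r"
  shows "ok (2 * n) prune_prog s (\<lambda>s'. arr s' ''mark'' = (\<lambda>v. if v \<in> T then 1 else 0) \<and>
    (\<forall>v<n. v \<noteq> r \<longrightarrow> arr s' ''par'' v = par v))"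
  unfolding prune_prog_def
proof (rule ok_Seq[where ?Q1.0 = "\<lambda>s'. reg s' ''i'' = 0"], goal_cases)
  case (2 s1)
  show ?case
  proof (rule ok_Seq[where ?Q1.0 = "\<lambda>s'. reg s' ''v'' = 0"], goal_cases)
    case (2 s2)
    note fr1 = \<open>frame _ s s1\<close> and fr2 = \<open>frame _ s1 s2\<close>
    have in2: "input_ok s2"
      by (rule input_ok_frame[OF fr2 input_ok_frame[OF fr1 assms(1)]]) simp_all
    have a2: "arr s2 a = arr s a" for a using fr1 fr2 by (simp add: frame_def)
    have r2: "reg s2 ''r'' = r" "reg s2 ''i'' = 0" "reg s2 ''v'' = 0" "reg s2 ''n'' = n"
      using fr1 fr2 assms(5) \<open>reg s1 ''i'' = 0\<close> 2(2) in2 by (simp_all add: frame_def input_ok_def)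
    have n0: "0 < n" using root by auto
    show ?case
    proof (rule ok_While[where k = "2 * n" and
        I = "\<lambda>k s'. \<exists>X. prune_inv X s' \<and> k = (n - reg s' ''i'') + (n - card X)"], goal_cases)
      case 1 show ?case by simp
    next
      case 2
      have "prune_inv {} s2" using assms a2 r2 n0 by (simp add: prune_inv_def pruned_def)
      then show ?case using r2 by (intro exI[of _ "{}"]) simp
    next
      case 3 show ?case by simp
    next
      case (4 k s')
      then obtain X where J: "prune_inv X s'" and k: "k = (n - reg s' ''i'') + (n - card X)" by blast
      have rn: "reg s' ''n'' = n" "reg s' ''r'' = r" using 4(2) r2 by (simp_all add: frame_def)
      define i where "i = reg s' ''i''"
      define v where "v = reg s' ''v''"
      have i: "i < n" using 4(3) rn by (simp add: i_def)
      have X: "pruned X" and deg: "\<And>u. u < n \<Longrightarrow> arr s' ''deg'' u = (if u \<in> X then 0 else card (nb u - X))"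
        and sum: "\<And>u. u < n \<Longrightarrow> u \<notin> X \<Longrightarrow> arr s' ''sum'' u = \<Sum>(nb u - X)"
        and par: "\<And>u. u \<in> X \<Longrightarrow> arr s' ''par'' u = par u"
        and mark: "arr s' ''mark'' = (\<lambda>u. if u \<in> U \<or> (\<exists>c\<in>X. par c = u \<and> c \<in> T) then 1 else 0)"
        and v: "v < n" and dn: "\<And>j. j \<le> i \<Longrightarrow> j < n \<Longrightarrow> j \<noteq> v \<Longrightarrow> j = r \<or> arr s' ''deg'' j \<noteq> 1"
        using J i by (auto simp: prune_inv_def i_def v_def)
      have XV: "X \<subseteq> {0..<n} - {r}" using X by (simp add: pruned_def)
      then have finX: "finite X" by (rule finite_subset) simp
      show ?case
      proof (cases "v \<noteq> r \<and> arr s' ''deg'' v = 1")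
        case False
        \<comment> \<open>The current vertex is the root or no leaf. With it cleared, no index up to
          \<open>i\<close> is a removable leaf, and the scan moves on.\<close>
        let ?s = "s'\<lparr>reg := (reg s')(''i'' := Suc i, ''v'' := Suc i)\<rparr>"
        have "prune_inv X ?s"
          using J i False dn unfolding prune_inv_def by (auto simp: le_Suc_eq v_def[symmetric] i_def[symmetric])
        then show ?thesis
          using False i k rn by (intro exI[of _ "(n - Suc i) + (n - card X)"]) (auto simp: i_def v_def intro!: exI[of _ X])
      next
        case True
        \<comment> \<open>Removed vertices have stored degree 0, so a stored degree 1 shows that
          \<open>v\<close> is still present.\<close>
        then have vr: "v \<noteq> r" and vX: "v \<notin> X" and leaf: "card (nb v - X) = 1"
          using deg[OF v] by (auto split: if_splits)
        define p where "p = par v"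
        note L = pruned_leaf[OF X v vr vX leaf]
        have p: "p < n" "p \<noteq> v" "p \<notin> X" using par_less par_neq v vr L(1) by (auto simp: p_def)
        have sv: "arr s' ''sum'' v = p" using sum[OF v vX] L(1) by (simp add: p_def)
        have vp: "v \<in> nb p - X" using v vr vX by (auto simp: in_nb_iff p_def)
        have nbp: "nb p - insert v X = (nb p - X) - {v}" by blast
        \<comment> \<open>The only remaining neighbour of \<open>v\<close> is \<open>p\<close>, so
          its removal affects the remaining neighbours of \<open>p\<close> alone.\<close>
        have nbu: "nb u - insert v X = nb u - X" if u: "u \<notin> insert v X" "u \<noteq> p" "u < n" for u
        proof -
          have "v \<notin> nb u"
          proof
            assume "v \<in> nb u"
            then have "u \<in> nb v - X" using u by (auto simp: in_nb_iff)
            then show False using L(1) u(2) by (simp add: p_def)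
          qed
          then show ?thesis by blast
        qed
        \<comment> \<open>All children of \<open>v\<close> are already in \<open>X\<close>, so the
          mark of \<open>v\<close> is final.\<close>
        have vT: "v \<in> T \<longleftrightarrow> v \<in> U \<or> (\<exists>c\<in>X. par c = v \<and> c \<in> T)"
          using in_T_iff[of v] L(2) XV by fastforce
        have mv: "arr s' ''mark'' v = 1 \<longleftrightarrow> v \<in> T" using vT by (simp add: mark)
        let ?s = "run (Assign ''p'' (Elem ''sum'' (V ''v'')) ;;
         Update ''par'' (V ''v'') (V ''p'') ;;
         Update ''deg'' (V ''v'') (N 0) ;;
         Update ''deg'' (V ''p'') (Minus (Elem ''deg'' (V ''p'')) (N 1)) ;;
         Update ''sum'' (V ''p'') (Minus (Elem ''sum'' (V ''p'')) (V ''v'')) ;;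
         If (Equal (Elem ''mark'' (V ''v'')) (N 1)) (Update ''mark'' (V ''p'') (N 1)) Skip ;;
         Assign ''v'' (V ''p'')) s'"
        have run: "arr ?s ''deg'' = (arr s' ''deg'')(v := 0, p := arr s' ''deg'' p - 1)"
          "arr ?s ''sum'' = (arr s' ''sum'')(p := arr s' ''sum'' p - v)"
          "arr ?s ''par'' = (arr s' ''par'')(v := p)"
          "arr ?s ''mark'' = (if v \<in> T then (arr s' ''mark'')(p := 1) else arr s' ''mark'')"
          "reg ?s ''i'' = i" "reg ?s ''v'' = p"
          using sv mv p by (auto simp: v_def[symmetric] i_def[symmetric] fun_eq_iff)
        have "prune_inv (insert v X) ?s"
          unfolding prune_inv_def run
        proof (intro conjI allI impI ballI)
          show "pruned (insert v X)" by (rule L(3))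
          fix u assume u: "u < n"
          show "((arr s' ''deg'')(v := 0, p := arr s' ''deg'' p - 1)) u =
            (if u \<in> insert v X then 0 else card (nb u - insert v X))"
          proof -
            consider "u = v" | "u \<in> X" | "u = p" | "u \<notin> insert v X" "u \<noteq> p" by blast
            then show ?thesis
            proof cases
              case 1 then show ?thesis using p by simp
            next
              case 2 then show ?thesis using deg[OF u] p vX by auto
            next
              case 3
              have "card (nb p - X - {v}) = card (nb p - X) - 1"
                using vp finite_nb[of p] by (intro card_Diff_singleton) auto
              then show ?thesis using 3 deg[OF u] p nbp by simp
            next
              case 4 then show ?thesis using deg[OF u] nbu[of u] u by simp
            qed
          qed
          assume uX: "u \<notin> insert v X"
          show "((arr s' ''sum'')(p := arr s' ''sum'' p - v)) u = \<Sum>(nb u - insert v X)"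
          proof (cases "u = p")
            case True
            have "\<Sum>(nb p - X) = v + \<Sum>(nb p - X - {v})"
              using vp finite_nb[of p] by (subst sum.remove[of _ v]) auto
            then show ?thesis using True sum[OF u] uX nbp by simp
          next
            case False then show ?thesis using sum[OF u] uX nbu[of u] u by simp
          qed
        next
          fix u assume "u \<in> insert v X"
          then show "((arr s' ''par'')(v := p)) u = par u" using par p by (auto simp: p_def)
        next
          show "(if v \<in> T then (arr s' ''mark'')(p := 1) else arr s' ''mark'') =
            (\<lambda>u. if u \<in> U \<or> (\<exists>c\<in>insert v X. par c = u \<and> c \<in> T) then 1 else 0)"
            by (auto simp: mark p_def fun_eq_iff)
        next
          \<comment> \<open>Stored degrees change only at \<open>v\<close>, where it is now 0, and
            at \<open>p\<close>, which is inspected next.\<close>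
          fix j assume j: "j \<le> i" "j < n" "j \<noteq> p"
          show "j = r \<or> ((arr s' ''deg'')(v := 0, p := arr s' ''deg'' p - 1)) j \<noteq> 1"
            using dn[of j] j by auto
        qed (use i p in auto)
        moreover have "card (insert v X) = Suc (card X)" using finX vX by simp
        moreover have "card (insert v X) \<le> n"
          using card_mono[of "{0..<n}" "insert v X"] XV v by auto
        ultimately have "\<exists>j<k. \<exists>X. prune_inv X ?s \<and> j = (n - reg ?s ''i'') + (n - card X)"
          unfolding run(5) k i_def[symmetric]
          by (intro exI[of _ "(n - i) + (n - card (insert v X))"] conjI exI[of _ "insert v X"]) auto
        moreover have "bval (Conj (Neg (Equal (V ''v'') (V ''r''))) (Equal (Elem ''deg'' (V ''v'')) (N 1))) s'"
          using True rn by (simp add: v_def)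
        ultimately show ?thesis by (simp only: run.simps(5) if_True)
      qed
    next
      case (5 k s')
      then obtain X where J: "prune_inv X s'" by blast
      have "reg s' ''n'' = n" using 5(2) r2 by (simp add: frame_def)
      then have i: "reg s' ''i'' = n" "reg s' ''v'' = n" using J 5(3) by (auto simp: prune_inv_def split: if_splits)
      have XV: "X = {0..<n} - {r}"
      proof (rule pruned_all)
        show "pruned X" using J by (simp add: prune_inv_def)
        fix v assume v: "v < n" "v \<noteq> r" "v \<notin> X"
        have dn: "\<forall>j\<le>n. j < n \<longrightarrow> j \<noteq> n \<longrightarrow> j = r \<or> arr s' ''deg'' j \<noteq> 1"
          and deg: "\<forall>u<n. arr s' ''deg'' u = (if u \<in> X then 0 else card (nb u - X))"
          using J unfolding prune_inv_def i by blast+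
        have "arr s' ''deg'' v \<noteq> 1" using dn[rule_format, of v] v by simp
        then show "card (nb v - X) \<noteq> 1" using deg v by simp
      qed
      \<comment> \<open>All vertices except the root are removed, so every child has passed on its
        mark.\<close>
      have "(u \<in> U \<or> (\<exists>c\<in>X. par c = u \<and> c \<in> T)) \<longleftrightarrow> u \<in> T" for u
        using in_T_iff[of u] unfolding XV by auto
      then show ?case using J XV by (auto simp: prune_inv_def)
    qed
  qed (auto intro: ok_run)
qed (auto intro: ok_run)

section \<open>Feasibility test and renumbering\<close>

lemma ok_absent:
  assumes "input_ok s" "arr s ''cnt'' = (\<lambda>x. card {v. v < n \<and> chi v = x})"
  shows "ok (2 * n) absent_prog s (\<lambda>s'. reg s' ''bad'' = (if set ms \<subseteq> chi ` {0..<n} then 0 else 1))"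
  unfolding absent_prog_def
proof (rule ok_Seq[where ?Q1.0 = "\<lambda>s'. reg s' ''bad'' = 0"], goal_cases)
  case (2 s1)
  have s1: "input_ok s1" by (rule input_ok_frame[OF 2(1) assms(1)]) simp_all
  have cnt: "arr s1 ''cnt'' = (\<lambda>x. card {v. v < n \<and> chi v = x})"
    using frame_arr[OF 2(1), of "''cnt''"] assms by simp
  show ?case
  proof (rule ok_For[where I = "\<lambda>i s'. reg s' ''bad'' = (if set (take i ms) \<subseteq> chi ` {0..<n} then 0 else 1)"], goal_cases)
    case (8 i s')
    have ok: "input_ok s'" by (rule input_ok_frame[OF 8(1) s1]) simp_all
    have i: "i < length ms" using 8(2) s1 by (simp add: input_ok_def)
    have x: "arr s' ''in'' (4 + reg s' ''i'') = ms ! i" using ok 8(3) i by (simp add: input_ok_def)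
    have "finite {v. v < n \<and> chi v = x}" for x by simp
    then have c: "arr s' ''cnt'' x = 0 \<longleftrightarrow> x \<notin> chi ` {0..<n}" for x
      using frame_arr[OF 8(1), of "''cnt''"] cnt by auto
    have "set (take (Suc i) ms) = insert (ms ! i) (set (take i ms))"
      using i by (simp add: take_Suc_conv_app_nth)
    then show ?case using x c 8(4) by simp
  qed (use s1 2 length_ms in \<open>auto simp: input_ok_def\<close>)
qed (auto intro: ok_run)

text \<open>Injectivity on \<open>T\<close> is tested incrementally: adding vertex \<open>i\<close>
  preserves it iff the colour of \<open>i\<close> has not been seen on an earlier vertex of
  \<open>T\<close>.\<close>

lemma ok_forced:
  assumes "input_ok s" "arr s ''M'' = (\<lambda>x. if x \<in> set ms then 1 else 0)"
    "arr s ''mark'' = (\<lambda>v. if v \<in> T then 1 else 0)" "arr s ''seen'' = (\<lambda>_. 0)"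
    "reg s ''bad'' = (if set ms \<subseteq> chi ` {0..<n} then 0 else 1)"
  shows "ok (2 * n) forced_prog s (\<lambda>s'. reg s' ''bad'' = (if bad then 1 else 0) \<and>
    arr s' ''seen'' = (\<lambda>x. if x \<in> chi ` T then 1 else 0))"
  unfolding forced_prog_def
proof (rule ok_For[where I = "\<lambda>i s'. reg s' ''bad'' = (if set ms \<subseteq> chi ` {0..<n} \<and>
      chi ` (T \<inter> {..<i}) \<subseteq> set ms \<and> inj_on chi (T \<inter> {..<i}) then 0 else 1) \<and>
      arr s' ''seen'' = (\<lambda>x. if x \<in> chi ` (T \<inter> {..<i}) then 1 else 0)"], goal_cases)
  case (8 i s')
  have ok: "input_ok s'" by (rule input_ok_frame[OF 8(1) assms(1)]) simp_all
  have i: "i < n" using 8(2) assms(1) by (simp add: input_ok_def)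
  have x: "arr s' ''in'' (reg s' ''cb'' + i) = chi i" using ok i by (simp add: input_ok_def)
  have a: "arr s' ''M'' = (\<lambda>x. if x \<in> set ms then 1 else 0)" "arr s' ''mark'' = (\<lambda>v. if v \<in> T then 1 else 0)"
    using frame_arr[OF 8(1), of "''M''"] frame_arr[OF 8(1), of "''mark''"] assms by simp_all
  show ?case
  proof (cases "i \<in> T")
    case True
    then have "T \<inter> {..<Suc i} = insert i (T \<inter> {..<i})" by auto
    moreover have "i \<notin> T \<inter> {..<i}" by simp
    ultimately show ?thesis using True 8(3,4) x a
      by (auto simp: fun_eq_iff)
  next
    case False
    then have "T \<inter> {..<Suc i} = T \<inter> {..<i}" by (auto simp: less_Suc_eq)
    then show ?thesis using False 8(3,4) a by simp
  qed
next
  case (9 s')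
  have n: "reg s ''n'' = n" using assms(1) by (simp add: input_ok_def)
  have T: "T \<inter> {..<n} = T" using T_less by auto
  from 9(2)[unfolded n T] show ?case by (simp add: bad_def)
qed (use assms in \<open>auto simp: input_ok_def\<close>)

lemma ok_recolor:
  assumes "input_ok s" "arr s ''seen'' = (\<lambda>x. if x \<in> chi ` T then 1 else 0)" "reg s ''r'' = r"
    "arr s ''ncol'' = (\<lambda>_. 0)"
  shows "ok (2 * n) recolor_prog s (\<lambda>s'. reg s' ''q'' = length cl \<and> arr s' ''ncol'' = newcol)"
  unfolding recolor_prog_def
proof (rule ok_Seq[where ?Q1.0 = "\<lambda>s'. reg s' ''q'' = 0"], goal_cases)
  case (2 s1)
  let ?P = "\<lambda>x. x \<notin> chi ` T \<or> x = chi r"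
  let ?cl = "\<lambda>i. filter ?P (take i ms)"
  have s1: "input_ok s1" by (rule input_ok_frame[OF 2(1) assms(1)]) simp_all
  show ?case
  proof (rule ok_For[where I = "\<lambda>i s'. reg s' ''q'' = length (?cl i) \<and>
      arr s' ''ncol'' = (\<lambda>x. if x \<in> set (?cl i) then Suc (pos cl x) else 0)"], goal_cases)
    case (8 i s')
    have ok: "input_ok s'" by (rule input_ok_frame[OF 8(1) s1]) simp_all
    have i: "i < length ms" using 8(2) s1 by (simp add: input_ok_def)
    have x: "arr s' ''in'' (4 + i) = ms ! i" using ok i by (simp add: input_ok_def)
    have r: "reg s' ''r'' = r" "arr s' ''seen'' = (\<lambda>x. if x \<in> chi ` T then 1 else 0)"
      using frame_arr[OF 8(1), of "''seen''"] frame_arr[OF 2(1), of "''seen''"]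
        frame_reg[OF 8(1), of "''r''"] frame_reg[OF 2(1), of "''r''"] assms by simp_all
    have cr: "arr s' ''in'' (reg s' ''cb'' + r) = chi r" using ok root by (simp add: input_ok_def)
    have S: "?cl (Suc i) = ?cl i @ (if ?P (ms ! i) then [ms ! i] else [])"
      using i by (simp add: take_Suc_conv_app_nth)
    show ?case
    proof (cases "?P (ms ! i)")
      case True
      have "filter ?P ms = filter ?P (take i ms @ ms ! i # drop (Suc i) ms)"
        using id_take_nth_drop[OF i] by presburger
      also have "\<dots> = ?cl i @ ms ! i # filter ?P (drop (Suc i) ms)"
        by (simp only: filter_append filter.simps True if_True)
      finally have clE: "cl = ?cl i @ ms ! i # filter ?P (drop (Suc i) ms)" by (simp only: cl_def)
      have nin: "ms ! i \<notin> set (?cl i)"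
        using distinct_ms i by (auto simp: in_set_conv_nth distinct_conv_nth)
      \<comment> \<open>Motif colours do not repeat, so the position in the final list is the number
        of colours kept so far.\<close>
      have "pos cl (ms ! i) = length (?cl i)" by (subst clE) (rule pos_append[OF nin])
      then show ?thesis using True S 8(3,4) x r cr by (auto simp: fun_eq_iff)
    next
      case False
      then show ?thesis using S 8(3,4) x r cr by auto
    qed
  next
    case (9 s')
    have "reg s1 ''m'' = length ms" using s1 by (simp add: input_ok_def)
    moreover have "?cl (length ms) = cl" by (simp add: cl_def)
    ultimately show ?case using 9(2) by (simp only: newcol_def fun_eq_iff) simp
  qed (use s1 2 length_ms assms frame_arr[OF 2(1), of "''ncol''"] in \<open>auto simp: input_ok_def\<close>)
qed (auto intro: ok_run)

lemma ok_renumber: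
  assumes "input_ok s" "arr s ''mark'' = (\<lambda>v. if v \<in> T then 1 else 0)" "reg s ''r'' = r"
    "arr s ''idx'' = (\<lambda>_. 0)"
  shows "ok (2 * n) renumber_prog s (\<lambda>s'. reg s' ''k'' = length kl \<and>
    (\<forall>u<length kl. arr s' ''kl'' u = kl ! u) \<and> (\<forall>v<n. arr s' ''idx'' v = idx v))"
  unfolding renumber_prog_def
proof (rule ok_Seq[where ?Q1.0 = "\<lambda>s'. reg s' ''k'' = 1"], goal_cases)
  case (2 s1)
  note fr1 = 2(1) and k1 = 2(2)
  show ?case
  proof (rule ok_Seq[where ?Q1.0 = "\<lambda>s'. arr s' ''kl'' 0 = r"], goal_cases)
    case 1
    have "reg s1 ''r'' = r" using frame_reg[OF fr1, of "''r''"] assms by simp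
    then show ?case by (auto intro: ok_run)
  next
    case (2 s2)
    have s2: "input_ok s2"
      by (rule input_ok_frame[OF 2(1) input_ok_frame[OF fr1 assms(1)]]) simp_all
    have e2: "reg s2 ''r'' = r" "reg s2 ''k'' = 1" "arr s2 ''mark'' = (\<lambda>v. if v \<in> T then 1 else 0)"
      "arr s2 ''idx'' = (\<lambda>_. 0)"
      using 2(1) fr1 k1 assms by (simp_all add: frame_def)
    let ?kl = "\<lambda>i. r # filter (\<lambda>v. v \<notin> K) [0..<i]"
    show ?case
    proof (rule ok_For[where I = "\<lambda>i s'. reg s' ''k'' = length (?kl i) \<and>
        (\<forall>u<length (?kl i). arr s' ''kl'' u = ?kl i ! u) \<and>
        (\<forall>v. arr s' ''idx'' v = (if v < i then idx v else 0))"], goal_cases)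
      case (8 i s')
      have i: "i < n" using 8(2) s2 by (simp add: input_ok_def)
      have r: "reg s' ''r'' = r" "arr s' ''mark'' = (\<lambda>v. if v \<in> T then 1 else 0)"
        using frame_arr[OF 8(1), of "''mark''"] frame_reg[OF 8(1), of "''r''"] e2 by simp_all
      have K: "i \<in> K \<longleftrightarrow> i = r \<or> i \<in> T" by (simp add: K_def)
      show ?case
      proof (cases "i \<in> K")
        case True
        then have "?kl (Suc i) = ?kl i" "idx i = 0" by (simp_all add: idx_K)
        then show ?thesis using True K 8(3,4) r by (auto simp: less_Suc_eq)
      next
        case False
        have S: "?kl (Suc i) = ?kl i @ [i]" using False by simp
        have "[0..<n] = [0..<i] @ i # [Suc i..<n]"
          using i upt_add_eq_append[of 0 i "n - i"] upt_conv_Cons[of i n] by simp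
        then have klE: "kl = ?kl i @ i # filter (\<lambda>v. v \<notin> K) [Suc i..<n]"
          unfolding kl_def using False by simp
        have nin: "i \<notin> set (?kl i)" using False K by auto
        \<comment> \<open>Likewise, the position of \<open>i\<close> in the final list is the number
          of vertices listed so far, with \<open>r\<close> in front.\<close>
        have "pos kl i = length (?kl i)" by (subst klE) (rule pos_append[OF nin])
        then have ix: "idx i = length (?kl i)" using False by (simp add: idx_def)
        have nth: "?kl (Suc i) ! u = (if u < length (?kl i) then ?kl i ! u else i)" if "u < Suc (length (?kl i))" for u
          unfolding S using that by (simp only: nth_append) (auto simp: less_Suc_eq)
        have len: "length (?kl (Suc i)) = Suc (length (?kl i))" unfolding S by simp
        show ?thesis unfolding len
          using False K 8(3,4) r ix nth by (auto simp: less_Suc_eq simp del: upt_Suc)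
      qed
    next
      case (9 s')
      have "reg s2 ''n'' = n" using s2 by (simp add: input_ok_def)
      from 9(2)[unfolded this] show ?case by (simp add: kl_def)
    qed (use s2 2 e2 in \<open>auto simp: input_ok_def\<close>)
  qed
qed (auto intro: ok_run)

section \<open>Writing the kernel\<close>

text \<open>Each kernel vertex other than 0 contributes the edge to its parent, hence
  \<open>length kl - 1\<close> edges.\<close>

definition kernel_output :: "nat list" where
  "kernel_output = [length kl, Suc (length cl), length cl, length kl - 1] @ map Suc [0..<length cl] @
     map chi' [0..<length kl] @ map Suc [0..<length kl - 1] @ map (\<lambda>i. par' (Suc i)) [0..<length kl - 1]"

text \<open>An index set is used rather than a prefix length because the last loop fills the two
  blocks of end points side by side.\<close>

definition filled :: "state \<Rightarrow> nat set \<Rightarrow> bool" where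
  "filled s A \<longleftrightarrow> (\<forall>j\<in>A. arr s ''out'' j = kernel_output ! j)"

lemma nth_output:
  "j < length cl \<Longrightarrow> kernel_output ! (4 + j) = Suc j"
  "j < length kl \<Longrightarrow> kernel_output ! (4 + length cl + j) = chi' j"
  "j < length kl - 1 \<Longrightarrow> kernel_output ! (4 + length cl + length kl + j) = Suc j"
  "j < length kl - 1 \<Longrightarrow> kernel_output ! (4 + length cl + length kl + (length kl - 1) + j) = par' (Suc j)"
proof -
  define p where "p = [length kl, Suc (length cl), length cl, length kl - 1] @ map Suc [0..<length cl] @
     map chi' [0..<length kl] @ map Suc [0..<length kl - 1]"
  assume j: "j < length kl - 1"
  have "kernel_output = p @ map (\<lambda>i. par' (Suc i)) [0..<length kl - 1]"
    by (simp add: kernel_output_def p_def)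
  moreover have "4 + length cl + length kl + (length kl - 1) = length p" by (simp add: p_def)
  ultimately show "kernel_output ! (4 + length cl + length kl + (length kl - 1) + j) = par' (Suc j)"
    using j by (simp only: nth_append_length_plus) simp
qed (simp_all add: kernel_output_def nth_append nth_Cons')

definition output_regs :: "state \<Rightarrow> bool" where
  "output_regs s \<longleftrightarrow> reg s ''k'' = length kl \<and> reg s ''q'' = length cl \<and> reg s ''l'' = length kl - 1 \<and>
     reg s ''ob'' = 4 + length cl \<and> reg s ''pb'' = 4 + length cl + length kl \<and>
     reg s ''pc'' = 4 + length cl + length kl + (length kl - 1) \<and> reg s ''out_len'' = length kernel_output"

lemma output_regs_frame:
  assumes "frame c s s'" "output_regs s" "''k'' \<notin> rmod c" "''q'' \<notin> rmod c" "''l'' \<notin> rmod c"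
    "''ob'' \<notin> rmod c" "''pb'' \<notin> rmod c" "''pc'' \<notin> rmod c" "''out_len'' \<notin> rmod c"
  shows "output_regs s'"
  using assms by (simp add: output_regs_def frame_def)

lemma ok_out_head:
  assumes "reg s ''k'' = length kl" "reg s ''q'' = length cl"
  shows "ok b out_head_prog s (\<lambda>s'. output_regs s' \<and> filled s' {..<4})"
proof (rule ok_run)
  have "{..<4} = {0, 1, 2, 3::nat}" by auto
  then show "output_regs (run out_head_prog s) \<and> filled (run out_head_prog s) {..<4}"
    using assms by (simp add: out_head_prog_def output_regs_def filled_def kernel_output_def)
qed (simp add: out_head_prog_def)

lemma length_kl_n: "length kl \<le> n"
proof -
  have "set kl \<subseteq> {0..<n}" using root by (auto simp: set_kl)
  then have "card (set kl) \<le> card {0..<n}" by (intro card_mono) auto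
  then show ?thesis using distinct_card[OF distinct_kl] by simp
qed

lemma length_cl_n: "length cl \<le> n"
  using length_filter_le[of _ ms] length_ms le_trans unfolding cl_def by blast

lemma ok_out_motif:
  assumes "output_regs s" "filled s {..<4}"
  shows "ok (2 * n) out_motif_prog s (\<lambda>s'. filled s' {..<4 + length cl})"
  unfolding out_motif_prog_def
proof (rule ok_For[where I = "\<lambda>i s'. filled s' {..<4 + i}"], goal_cases)
  case (8 i s')
  have i: "i < length cl" using 8(2) assms(1) by (simp add: output_regs_def)
  have S: "{..<4 + Suc i} = insert (4 + i) {..<4 + i}" by auto
  show ?case unfolding S using 8(3,4) nth_output(1)[OF i] by (simp add: filled_def)
qed (use assms length_cl_n in \<open>auto simp: output_regs_def filled_def\<close>)

lemma ok_out_color: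
  assumes "output_regs s" "input_ok s" "filled s {..<4 + length cl}"
    "\<forall>u<length kl. arr s ''kl'' u = kl ! u" "arr s ''ncol'' = newcol"
  shows "ok (2 * n) out_color_prog s (\<lambda>s'. filled s' {..<4 + length cl + length kl})"
  unfolding out_color_prog_def
proof (rule ok_For[where I = "\<lambda>i s'. filled s' {..<4 + length cl + i}"], goal_cases)
  case (8 i s')
  have i: "i < length kl" using 8(2) assms(1) by (simp add: output_regs_def)
  have ok: "input_ok s'" by (rule input_ok_frame[OF 8(1) assms(2)]) simp_all
  have rg: "output_regs s'" by (rule output_regs_frame[OF 8(1) assms(1)]) simp_all
  have a: "arr s' ''kl'' i = kl ! i" "arr s' ''ncol'' = newcol"
    using frame_arr[OF 8(1), of "''kl''"] frame_arr[OF 8(1), of "''ncol''"] assms i by simp_all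
  have c: "arr s' ''in'' (reg s' ''cb'' + kl ! i) = chi (kl ! i)"
    using ok kl_less[OF i] by (simp add: input_ok_def)
  have ob: "reg s' ''ob'' = 4 + length cl" using rg by (simp add: output_regs_def)
  have S: "{..<4 + length cl + Suc i} = insert (4 + length cl + i) {..<4 + length cl + i}" by auto
  show ?case unfolding S using 8(3,4) nth_output(2)[OF i] a c ob by (simp add: filled_def chi'_def)
qed (use assms length_kl_n in \<open>auto simp: output_regs_def filled_def\<close>)

lemma ok_out_edge:
  assumes "output_regs s" "filled s {..<4 + length cl + length kl}"
    "\<forall>u<length kl. arr s ''kl'' u = kl ! u" "\<forall>v<n. arr s ''idx'' v = idx v"
    "\<forall>v<n. v \<noteq> r \<longrightarrow> arr s ''par'' v = par v"
  shows "ok (2 * n) out_edge_prog s (\<lambda>s'. map (arr s' ''out'') [0..<reg s' ''out_len''] = kernel_output)"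
  unfolding out_edge_prog_def
proof -
  define pb where "pb = 4 + length cl + length kl"
  define l where "l = length kl - 1"
  show "ok (2 * n) (For ''i'' ''l''
     (Update ''out'' (Plus (V ''pb'') (V ''i'')) (Plus (V ''i'') (N 1)) ;;
      Update ''out'' (Plus (V ''pc'') (V ''i''))
        (Elem ''idx'' (Elem ''par'' (Elem ''kl'' (Plus (V ''i'') (N 1))))))) s
    (\<lambda>s'. map (arr s' ''out'') [0..<reg s' ''out_len''] = kernel_output)"
  proof (rule ok_For[where I = "\<lambda>i s'. filled s' ({..<pb + i} \<union> {pb + l..<pb + l + i})"], goal_cases)
    case (8 i s')
    have i: "i < l" using 8(2) assms(1) by (simp add: output_regs_def l_def)
    then have i': "Suc i < length kl" by (simp add: l_def)
    have rg: "output_regs s'" by (rule output_regs_frame[OF 8(1) assms(1)]) simp_all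
    have pb: "reg s' ''pb'' = pb" "reg s' ''pc'' = pb + l"
      using rg by (simp_all add: output_regs_def pb_def l_def)
    \<comment> \<open>Only position 0 holds the root, so the parent of this vertex was recorded by
      the pruning.\<close>
    have v: "kl ! Suc i < n" "kl ! Suc i \<noteq> r" using kl_less[OF i'] kl_eq_r[OF i'] by auto
    then have "par (kl ! Suc i) < n" using par_in by auto
    then have p: "arr s' ''idx'' (arr s' ''par'' (arr s' ''kl'' (Suc i))) = par' (Suc i)"
      using frame_arr[OF 8(1), of "''kl''"] frame_arr[OF 8(1), of "''idx''"]
        frame_arr[OF 8(1), of "''par''"] assms(3-5) i' v by (simp add: par'_def)
    have o: "kernel_output ! (pb + i) = Suc i" "kernel_output ! (pb + l + i) = par' (Suc i)"
      using nth_output(3,4)[of i] i by (simp_all add: pb_def l_def)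
    have S: "{..<pb + Suc i} \<union> {pb + l..<pb + l + Suc i} =
      insert (pb + l + i) (insert (pb + i) ({..<pb + i} \<union> {pb + l..<pb + l + i}))" by auto
    show ?case unfolding S using 8(3,4) pb p o i by (simp add: filled_def)
  next
    case (9 s')
    have "reg s ''l'' = l" using assms(1) by (simp add: output_regs_def l_def)
    then have f: "filled s' ({..<pb + l} \<union> {pb + l..<pb + l + l})" using 9(2) by simp
    have "reg s' ''out_len'' = length kernel_output"
      using output_regs_frame[OF 9(1) assms(1)] by (simp add: output_regs_def)
    moreover have "length kernel_output = pb + l + l" by (simp add: kernel_output_def pb_def l_def)
    moreover have "{..<pb + l} \<union> {pb + l..<pb + l + l} = {..<pb + l + l}" by auto
    ultimately show ?case using f by (intro nth_equalityI) (auto simp: filled_def)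
  qed (use assms length_kl_n in \<open>auto simp: output_regs_def filled_def pb_def\<close>)
qed

lemma ok_reject:
  "ok b reject_prog s (\<lambda>s'. map (arr s' ''out'') [0..<reg s' ''out_len''] = [1, 1, 0, 0, 0])"
  by (rule ok_run) (simp_all add: reject_prog_def upt_rec)

lemma ok_kernel:
  "ok (2 * n) kernel_prog (init_state input)
     (\<lambda>s'. map (arr s' ''out'') [0..<reg s' ''out_len''] = (if bad then [1, 1, 0, 0, 0] else kernel_output))"
  (is "ok _ _ _ ?Q")
  unfolding kernel_prog_def
proof (rule ok_Seq[OF ok_read], goal_cases)
  case (1 s1)
  note i1 = 1(2)
  \<comment> \<open>All working arrays are still zero, the initial value that each later phase
    presupposes of its own arrays.\<close>
  have z: "arr s1 a = (\<lambda>_. 0)" if "a \<noteq> ''in''" for a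
    using 1(1) that by (simp add: frame_def read_prog_def init_state_def)
  show ?case
  proof (rule ok_Seq[OF ok_motif[OF i1 z]], simp, goal_cases)
    case (1 s2)
    have i2: "input_ok s2" by (rule input_ok_frame[OF 1(1) i1]) (simp_all add: motif_prog_def)
    note M = 1(2)
    have a2: "arr s2 a = arr s1 a" if "a \<noteq> ''M''" for a
      using 1(1) that by (simp add: frame_def motif_prog_def)
    show ?case
    proof (rule ok_Seq[OF ok_count[OF i2]], simp add: a2 z, goal_cases)
      case (1 s3)
      have i3: "input_ok s3" by (rule input_ok_frame[OF 1(1) i2]) (simp_all add: count_prog_def)
      note cnt = 1(2)
      have a3: "arr s3 a = arr s2 a" if "a \<noteq> ''cnt''" for a
        using 1(1) that by (simp add: frame_def count_prog_def)
      show ?case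
      proof (rule ok_Seq[OF ok_degree[OF i3]], simp add: a3 a2 z, simp add: a3 a2 z, goal_cases)
        case (1 s4)
        have i4: "input_ok s4" by (rule input_ok_frame[OF 1(1) i3]) (simp_all add: degree_prog_def)
        note deg = 1(2)
        have a4: "arr s4 a = arr s3 a" if "a \<noteq> ''deg''" "a \<noteq> ''sum''" for a
          using 1(1) that by (simp add: frame_def degree_prog_def)
        show ?case
        proof (rule ok_Seq[OF ok_unique[OF i4]], simp add: a4 a3 a2 z, simp add: a4 a3 M,
            simp add: a4 cnt, goal_cases)
          case (1 s5)
          have i5: "input_ok s5" by (rule input_ok_frame[OF 1(1) i4]) (simp_all add: unique_prog_def)
          note mark5 = conjunct1[OF 1(2)] and r5 = conjunct2[OF 1(2)]
          have a5: "arr s5 a = arr s4 a" if "a \<noteq> ''mark''" for a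
            using 1(1) that by (simp add: frame_def unique_prog_def)
          show ?case
          proof (rule ok_Seq[OF ok_prune[OF i5 _ _ mark5 r5]], simp add: a5 deg, simp add: a5 deg, goal_cases)
            case (1 s6)
            have i6: "input_ok s6" by (rule input_ok_frame[OF 1(1) i5]) (simp_all add: prune_prog_def)
            note mark = conjunct1[OF 1(2)] and par6 = conjunct2[OF 1(2)]
            have a6: "arr s6 a = arr s5 a" if "a \<noteq> ''par''" "a \<noteq> ''deg''" "a \<noteq> ''sum''" "a \<noteq> ''mark''" for a
              using 1(1) that by (simp add: frame_def prune_prog_def)
            have r6: "reg s6 ''r'' = r" using frame_reg[OF 1(1), of "''r''"] r5 by (simp add: prune_prog_def)
            show ?case
            proof (rule ok_Seq[OF ok_absent[OF i6]], simp add: a6 a5 a4 cnt, goal_cases)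
              case (1 s7)
              have i7: "input_ok s7" by (rule input_ok_frame[OF 1(1) i6]) (simp_all add: absent_prog_def)
              note bad7 = 1(2)
              have a7: "arr s7 a = arr s6 a" for a
                using 1(1) by (simp add: frame_def absent_prog_def)
              have r7: "reg s7 ''r'' = r" using frame_reg[OF 1(1), of "''r''"] r6 by (simp add: absent_prog_def)
              show ?case
              proof (rule ok_Seq[OF ok_forced[OF i7 _ _ _ bad7]], simp add: a7 a6 a5 a4 a3 M,
                  simp add: a7 mark, simp add: a7 a6 a5 a4 a3 a2 z, goal_cases)
                case (1 s8)
                have i8: "input_ok s8" by (rule input_ok_frame[OF 1(1) i7]) (simp_all add: forced_prog_def)
                note bad8 = conjunct1[OF 1(2)] and seen = conjunct2[OF 1(2)]
                have a8: "arr s8 a = arr s7 a" if "a \<noteq> ''seen''" for a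
                  using 1(1) that by (simp add: frame_def forced_prog_def)
                have r8: "reg s8 ''r'' = r" using frame_reg[OF 1(1), of "''r''"] r7 by (simp add: forced_prog_def)
                show ?case
                proof (rule ok_If, goal_cases)
                  case 1
                  then have "reg s8 ''bad'' = 1" by simp
                  then have bad using bad8 by presburger
                  then have "(if bad then [1, 1, 0, 0, 0] else kernel_output) = [1, 1, 0, 0, 0]" by (rule if_P)
                  then show ?case by (simp only: ok_reject)
                next
                  case 2
                  then have "reg s8 ''bad'' \<noteq> 1" by simp
                  then have good: "\<not> bad" using bad8 by presburger
                  show ?case
                  proof (rule ok_Seq[OF ok_recolor[OF i8 seen r8]], simp add: a8 a7 a6 a5 a4 a3 a2 z, goal_cases)
                    case (1 s9)
                    have i9: "input_ok s9" by (rule input_ok_frame[OF 1(1) i8]) (simp_all add: recolor_prog_def)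
                    note q9 = conjunct1[OF 1(2)] and ncol = conjunct2[OF 1(2)]
                    have a9: "arr s9 a = arr s8 a" if "a \<noteq> ''ncol''" for a
                      using 1(1) that by (simp add: frame_def recolor_prog_def)
                    have r9: "reg s9 ''r'' = r" using frame_reg[OF 1(1), of "''r''"] r8 by (simp add: recolor_prog_def)
                    show ?case
                    proof (rule ok_Seq[OF ok_renumber[OF i9 _ r9]], simp add: a9 a8 a7 mark,
                        simp add: a9 a8 a7 a6 a5 a4 a3 a2 z, goal_cases)
                      case (1 s10)
                      have i10: "input_ok s10" by (rule input_ok_frame[OF 1(1) i9]) (simp_all add: renumber_prog_def)
                      have k: "reg s10 ''k'' = length kl" and kl: "\<forall>u<length kl. arr s10 ''kl'' u = kl ! u"
                        and idx: "\<forall>v<n. arr s10 ''idx'' v = idx v" using 1(2) by blast+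
                      have a10: "arr s10 a = arr s9 a" if "a \<noteq> ''kl''" "a \<noteq> ''idx''" for a
                        using 1(1) that by (simp add: frame_def renumber_prog_def)
                      have q10: "reg s10 ''q'' = length cl"
                        using frame_reg[OF 1(1), of "''q''"] q9 by (simp add: renumber_prog_def)
                      have par10: "\<forall>v<n. v \<noteq> r \<longrightarrow> arr s10 ''par'' v = par v"
                        using par6 by (simp add: a10 a9 a8 a7)
                      show ?case
                      proof (rule ok_Seq[OF ok_out_head[OF k q10]], goal_cases)
                        case (1 s11)
                        have i11: "input_ok s11" by (rule input_ok_frame[OF 1(1) i10]) (simp_all add: out_head_prog_def)
                        note o11 = conjunct1[OF 1(2)] and f11 = conjunct2[OF 1(2)]
                        have a11: "arr s11 a = arr s10 a" if "a \<noteq> ''out''" for a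
                          using 1(1) that by (simp add: frame_def out_head_prog_def)
                        show ?case
                        proof (rule ok_Seq[OF ok_out_motif[OF o11 f11]], goal_cases)
                          case (1 s12)
                          have i12: "input_ok s12" by (rule input_ok_frame[OF 1(1) i11]) (simp_all add: out_motif_prog_def)
                          have o12: "output_regs s12" by (rule output_regs_frame[OF 1(1) o11]) (simp_all add: out_motif_prog_def)
                          note f12 = 1(2)
                          have a12: "arr s12 a = arr s11 a" if "a \<noteq> ''out''" for a
                            using 1(1) that by (simp add: frame_def out_motif_prog_def)
                          show ?case
                          proof (rule ok_Seq[OF ok_out_color[OF o12 i12 f12]], simp add: a12 a11 kl,
                              simp add: a12 a11 a10 ncol, goal_cases)
                            case (1 s13)
                            have o13: "output_regs s13" by (rule output_regs_frame[OF 1(1) o12]) (simp_all add: out_color_prog_def)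
                            have a13: "arr s13 a = arr s12 a" if "a \<noteq> ''out''" for a
                              using 1(1) that by (simp add: frame_def out_color_prog_def)
                            have "ok (2 * n) out_edge_prog s13
                              (\<lambda>s'. map (arr s' ''out'') [0..<reg s' ''out_len''] = kernel_output)"
                              by (rule ok_out_edge[OF o13 1(2)]) (use kl idx par10 in \<open>simp_all add: a13 a12 a11\<close>)
                            then show ?case using good by simp
                          qed
                        qed
                      qed
                    qed
                  qed
                qed
              qed
            qed
          qed
        qed
      qed
    qed
  qed
qed

end

section \<open>Encoded instances and final bounds\<close>

text \<open>A map that agrees with the colouring on \<open>S\<close> is bijective onto the motif iff
  the colouring itself is.\<close>

lemma (in rooted_tree) cgm_yes_iff:
  assumes "cgm_graph I = graph"
  shows "cgm_yes I \<longleftrightarrow> (\<exists>S\<subseteq>V. (\<exists>t\<in>S. \<forall>v\<in>S - {t}. v \<noteq> r \<and> par v \<in> S) \<and>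
    inj_on (cgm_coloring I) S \<and> cgm_coloring I ` S = cgm_motif I)"
proof -
  have "(\<exists>f. bij_betw f S M \<and> (\<forall>v\<in>S. f v = g v)) \<longleftrightarrow> inj_on g S \<and> g ` S = M"
    for g :: "'v \<Rightarrow> 'c" and S M
  proof
    assume "\<exists>f. bij_betw f S M \<and> (\<forall>v\<in>S. f v = g v)"
    then obtain f where "bij_betw f S M" "\<And>v. v \<in> S \<Longrightarrow> f v = g v" by blast
    then have "bij_betw g S M" using bij_betw_cong by metis
    then show "inj_on g S \<and> g ` S = M" by (simp add: bij_betw_def)
  qed (auto simp: bij_betw_def)
  then show ?thesis unfolding cgm_yes_def assms graph_simps
    by (intro ex_cong1 conj_cong refl) (simp_all add: connected_subset_iff)
qed

lemma reject_code:
  obtains I where "cgm_code [1, 1, 0, 0, 0] I" "\<not> cgm_yes I" "cgm_num_verts I = 1" "cgm_size I = 2"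
proof -
  interpret rooted_tree "{0::nat}" 0 "\<lambda>v. v" "\<lambda>v. v" by unfold_locales auto
  have up: "up = {}" by (auto simp: up_def)
  define I where "I = \<lparr>cgm_graph = graph, cgm_colors = {0::nat}, cgm_coloring = (\<lambda>_. 0), cgm_motif = {}\<rparr>"
  have "cgm_tree_instance I"
    using undirected_tree by (auto simp: cgm_tree_instance_def I_def)
  then have "cgm_code [1, 1, 0, 0, 0] I" unfolding cgm_code_def
    by (intro conjI exI[of _ "1::nat"] exI[of _ "[]"]) (auto simp: I_def up)
  moreover have "\<not> cgm_yes I" using cgm_yes_iff[of I] by (auto simp: I_def)
  moreover have "cgm_num_verts I = 1" "cgm_size I = 2"
    by (simp_all add: cgm_num_verts_def cgm_size_def I_def up)
  ultimately show ?thesis using that by blast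
qed

context kernel_run
begin

lemma set_up': "contracted.up = set (map (\<lambda>i. (Suc i, par' (Suc i))) [0..<length kl - 1])"
proof -
  have "(u, v) \<in> contracted.up \<longleftrightarrow> (\<exists>i<length kl - 1. u = Suc i \<and> v = par' (Suc i))" for u v
    by (cases u) (auto simp: contracted.in_up_iff)
  then show ?thesis by (auto simp: image_iff)
qed

text \<open>With \<open>k\<close> vertices there are at most \<open>2 * k\<close> arcs,
  \<open>k + 1\<close> colours including the extra colour 0, and \<open>k\<close> motif colours;
  this gives \<open>5 * k + 1\<close>.\<close>

lemma output_code:
  assumes good: "\<not> bad"
  obtains I where "cgm_code kernel_output I" "cgm_num_verts I = length kl" "cgm_size I \<le> 5 * length kl + 1"
    "cgm_yes I \<longleftrightarrow> (\<exists>S. rooted_solution (length kl) 0 par' chi' {1..length cl} S)"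
proof -
  define I where "I = \<lparr>cgm_graph = contracted.graph, cgm_colors = {0..<Suc (length cl)},
    cgm_coloring = chi', cgm_motif = {1..length cl}\<rparr>"
  define ms' where "ms' = map Suc [0..<length cl]"
  define es' where "es' = map (\<lambda>i. (Suc i, par' (Suc i))) [0..<length kl - 1]"
  have le: "length cl \<le> length kl" by (rule length_cl_le[OF good])
  have es': "set es' = contracted.up" unfolding es'_def by (rule set_up'[symmetric])
  have col: "chi' u < Suc (length cl)" for u by (simp add: chi'_def newcol_def Suc_le_eq pos_less)
  have ms': "distinct ms'" "set ms' = {1..length cl}"
  proof -
    have "Suc ` {0..<length cl} = {1..length cl}" by (simp add: image_Suc_atLeastLessThan atLeastLessThanSuc_atLeastAtMost)
    then show "distinct ms'" "set ms' = {1..length cl}" by (simp_all add: ms'_def distinct_map)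
  qed
  have es'_d: "distinct es'" by (auto simp: es'_def distinct_map inj_on_def)
  have inst: "cgm_tree_instance I"
    using contracted.undirected_tree col le by (auto simp: cgm_tree_instance_def I_def)
  have "cgm_code kernel_output I" unfolding cgm_code_def
  proof (rule conjI[OF inst], rule exI[of _ "length kl"], rule exI[of _ "Suc (length cl)"],
      rule exI[of _ ms'], rule exI[of _ es'], intro conjI)
    show "set es' \<inter> (set es')\<inverse> = {}" unfolding es' by (rule contracted.up_disjoint)
    show "kernel_output = [length kl, Suc (length cl), length ms', length es'] @ ms' @
      map (cgm_coloring I) [0..<length kl] @ map fst es' @ map snd es'"
      by (simp add: kernel_output_def ms'_def es'_def I_def comp_def)
  qed (use inst ms' es'_d es' in \<open>simp_all add: I_def\<close>)
  moreover have "cgm_num_verts I = length kl" by (simp add: cgm_num_verts_def I_def)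
  moreover have "cgm_size I \<le> 5 * length kl + 1"
  proof -
    have "card contracted.up \<le> length kl" using card_length[of es'] unfolding es'[symmetric] by (simp add: es'_def)
    then have "card (contracted.up \<union> contracted.up\<inverse>) \<le> 2 * length kl"
      using card_Un_le[of contracted.up "contracted.up\<inverse>"] by simp
    then show ?thesis using le by (simp add: cgm_size_def cgm_num_verts_def I_def)
  qed
  moreover have "cgm_yes I \<longleftrightarrow> (\<exists>S. rooted_solution (length kl) 0 par' chi' {1..length cl} S)"
    using contracted.cgm_yes_iff[of I] by (simp add: I_def rooted_solution_def)
  ultimately show ?thesis using that by blast
qed

end

text \<open>The bound \<open>2 * l + 1\<close> is claimed for every instance that the output word
  encodes; the word itself fixes the vertex count of all of them.\<close>

lemma cgm_code_num_verts: "cgm_code w I \<Longrightarrow> cgm_num_verts I = w ! 0"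
  by (auto simp: cgm_code_def cgm_num_verts_def)

text \<open>With \<open>l\<close> the parameter, the size bound is
  \<open>5 * (2 * l + 1) + 1\<close>, which also covers the rejecting output of size 2. Rejection is
  sound by \<open>bad_no_solution\<close>; otherwise solutions translate in both directions.\<close>

lemma kernel_correct:
  assumes code: "cgm_code w I"
  obtains t w' I' where "runs kernel_prog w t w'" "t \<le> weight kernel_prog * (2 * cgm_num_verts I + 1)"
    "cgm_num_verts I \<le> length w" "cgm_code w' I'" "cgm_yes I' \<longleftrightarrow> cgm_yes I"
    "cgm_num_verts I' \<le> 2 * cgm_param I + 1" "cgm_size I' \<le> 10 * cgm_param I + 6"
proof -
  from code obtain n c ms es where inst: "cgm_tree_instance I"
    and pv: "pverts (cgm_graph I) = {0..<n}" and ms: "distinct ms" "set ms = cgm_motif I"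
    and es: "distinct es" "set es \<inter> (set es)\<inverse> = {}" "parcs (cgm_graph I) = set es \<union> (set es)\<inverse>"
    and w: "w = [n, c, length ms, length es] @ ms @ map (cgm_coloring I) [0..<n] @ map fst es @ map snd es"
    unfolding cgm_code_def by blast
  define chi where "chi = cgm_coloring I"
  define U where "U = unique_verts n chi (set ms)"
  define r where "r = (if U = {} then 0 else Max U)"
  have tree: "undirected_tree (cgm_graph I)" using inst by (simp add: cgm_tree_instance_def)
  have lm: "length ms \<le> n"
    using inst distinct_card[OF ms(1)] ms(2) pv by (simp add: cgm_tree_instance_def)
  have "{0..<n} \<noteq> {}" using tree connected_iff pv unfolding undirected_tree_def by metis
  moreover have "finite U" by (rule finite_subset[of _ "{0..<n}"]) (auto simp: U_def unique_verts_def)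
  ultimately have r: "r < n" "U = {} \<or> r \<in> U"
    using Max_in[of U] by (auto simp: r_def U_def unique_verts_def)
  obtain par rk where rt: "rooted_tree {0..<n} r par rk"
    and arcs: "parcs (cgm_graph I) = rooted_tree.up {0..<n} r par \<union> (rooted_tree.up {0..<n} r par)\<inverse>"
    using undirected_tree_rooted[OF tree, of r] r pv by auto
  interpret T: rooted_tree "{0..<n}" r par rk by (rule rt)
  interpret kernel_run n r par rk chi ms es c
    by unfold_locales (use ms es arcs lm r in \<open>simp_all add: U_def r_def\<close>)
  have w: "w = input" unfolding w input_def unfolding chi_def by (rule refl)
  have graph: "cgm_graph I = T.graph"
    using pv arcs by (intro pair_pre_digraph.equality) simp_all
  have yes: "cgm_yes I \<longleftrightarrow> (\<exists>S. rooted_solution n r par chi (set ms) S)"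
    using T.cgm_yes_iff[OF graph] by (simp add: rooted_solution_def chi_def ms(2))
  have nv: "cgm_num_verts I = n" by (simp add: cgm_num_verts_def pv)
  have l: "cgm_param I = n - length ms"
    using distinct_card[OF ms(1)] ms(2) by (simp add: cgm_param_def nv)
  have len: "n \<le> length w" by (simp add: w input_def)
  obtain t where run: "runs kernel_prog w t (if bad then [1, 1, 0, 0, 0] else kernel_output)"
    "t \<le> weight kernel_prog * (2 * n + 1)"
    using ok_kernel unfolding ok_def runs_def w by metis
  show ?thesis
  proof (cases bad)
    case True
    obtain I' where I': "cgm_code [1, 1, 0, 0, 0] I'" "\<not> cgm_yes I'" "cgm_num_verts I' = 1" "cgm_size I' = 2"
      by (rule reject_code)
    have "\<not> cgm_yes I" using yes bad_no_solution[OF True] by blast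
    then show ?thesis using that[of t "[1, 1, 0, 0, 0]" I'] run True I' nv len by simp
  next
    case False
    obtain I' where I': "cgm_code kernel_output I'" "cgm_num_verts I' = length kl" "cgm_size I' \<le> 5 * length kl + 1"
      "cgm_yes I' \<longleftrightarrow> (\<exists>S. rooted_solution (length kl) 0 par' chi' {1..length cl} S)"
      by (rule output_code[OF False])
    have "cgm_yes I' \<longleftrightarrow> cgm_yes I"
      unfolding I' yes using solution_contract solution_expand[OF False] by blast
    moreover have "length kl \<le> 2 * cgm_param I + 1" using length_kl_le[OF False] lm l by simp
    ultimately show ?thesis using that[of t kernel_output I'] run False I' nv len by simp
  qed
qed

theorem theorem15:
  shows "\<exists>P. problem_kernel cgm_code cgm_yes cgm_param cgm_size P \<and>
    (\<forall>w I t w' I'. cgm_code w I \<and> runs P w t w' \<and> cgm_code w' I' \<longrightarrow>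
       cgm_num_verts I' \<le> 2 * cgm_param I + 1) \<and>
    (\<exists>T :: nat \<Rightarrow> nat. (\<lambda>n. real (T n)) \<in> O(\<lambda>n. real n) \<and>
       (\<forall>w I. cgm_code w I \<longrightarrow> (\<exists>t w'. runs P w t w' \<and> t \<le> T (cgm_num_verts I))))"
proof (intro exI[of _ kernel_prog] conjI)
  define W where "W = weight kernel_prog"
  have det: "w1 = w2" if "runs kernel_prog w t1 w1" "runs kernel_prog w t2 w2" for w t1 t2 w1 w2
    using that exec_det unfolding runs_def by metis
  show "problem_kernel cgm_code cgm_yes cgm_param cgm_size kernel_prog"
    unfolding problem_kernel_def
  proof (rule conjI; (rule exI[of _ "2 * W"], rule exI[of _ 1] | rule exI[of _ "\<lambda>l. 10 * l + 6"]); intro allI impI)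
    fix w I assume "cgm_code w I"
    then obtain t w' where t: "runs kernel_prog w t w'" "t \<le> W * (2 * cgm_num_verts I + 1)"
      "cgm_num_verts I \<le> length w" unfolding W_def by (rule kernel_correct)
    \<comment> \<open>An input word is at least as long as the number of vertices, so a bound linear
      in \<open>n\<close> is linear in the word length.\<close>
    have "W * (2 * cgm_num_verts I + 1) \<le> W * (2 * length w + 2)" using t(3) by (intro mult_le_mono) simp_all
    then have "t \<le> 2 * W * length w ^ 1 + 2 * W" using t(2) by (simp add: algebra_simps)
    then show "\<exists>t w'. runs kernel_prog w t w' \<and> t \<le> 2 * W * length w ^ 1 + 2 * W" using t(1) by blast
  next
    fix w I t w' assume a: "cgm_code w I \<and> runs kernel_prog w t w'"
    obtain t2 w2 I' where k: "runs kernel_prog w t2 w2" "cgm_code w2 I'" "cgm_yes I' \<longleftrightarrow> cgm_yes I"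
      "cgm_size I' \<le> 10 * cgm_param I + 6" by (rule kernel_correct[OF conjunct1[OF a]])
    have "w2 = w'" using det k(1) conjunct2[OF a] by blast
    then show "\<exists>I'. cgm_code w' I' \<and> (cgm_yes I' \<longleftrightarrow> cgm_yes I) \<and> cgm_size I' \<le> 10 * cgm_param I + 6"
      using k by blast
  qed
  show "\<forall>w I t w' I'. cgm_code w I \<and> runs kernel_prog w t w' \<and> cgm_code w' I' \<longrightarrow>
       cgm_num_verts I' \<le> 2 * cgm_param I + 1"
  proof (intro allI impI, elim conjE)
    fix w I t w' I' assume a: "cgm_code w I" "runs kernel_prog w t w'" "cgm_code w' I'"
    obtain t2 w2 I2 where k: "runs kernel_prog w t2 w2" "cgm_code w2 I2"
      "cgm_num_verts I2 \<le> 2 * cgm_param I + 1" by (rule kernel_correct[OF a(1)])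
    have "w2 = w'" using det k(1) a(2) by blast
    then have "cgm_num_verts I' = cgm_num_verts I2" using cgm_code_num_verts k(2) a(3) by simp
    then show "cgm_num_verts I' \<le> 2 * cgm_param I + 1" using k(3) by simp
  qed
  show "\<exists>T :: nat \<Rightarrow> nat. (\<lambda>n. real (T n)) \<in> O(\<lambda>n. real n) \<and>
       (\<forall>w I. cgm_code w I \<longrightarrow> (\<exists>t w'. runs kernel_prog w t w' \<and> t \<le> T (cgm_num_verts I)))"
  proof (intro exI[of _ "\<lambda>n. W * (2 * n + 1)"] conjI allI impI)
    show "(\<lambda>n. real (W * (2 * n + 1))) \<in> O(\<lambda>n. real n)"
    proof (rule bigoI[of _ "real (3 * W)"], rule eventually_sequentiallyI[of 1])
      fix n :: nat assume "1 \<le> n"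
      \<comment> \<open>From \<open>n = 1\<close> on, \<open>2 * n + 1\<close> is at most
        \<open>3 * n\<close>, which yields the constant \<open>3 * W\<close>.\<close>
      then have "W * (2 * n + 1) \<le> W * (3 * n)" by (intro mult_le_mono) simp_all
      then have "real (W * (2 * n + 1)) \<le> real (3 * W * n)" by (simp only: of_nat_le_iff ac_simps)
      then show "norm (real (W * (2 * n + 1))) \<le> real (3 * W) * norm (real n)" by simp
    qed
    fix w I assume "cgm_code w I"
    then obtain t w' where "runs kernel_prog w t w'" "t \<le> W * (2 * cgm_num_verts I + 1)"
      unfolding W_def by (rule kernel_correct)
    then show "\<exists>t w'. runs kernel_prog w t w' \<and> t \<le> W * (2 * cgm_num_verts I + 1)" by blast
  qed
qed

end
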